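(* For all integers $n\geq 0$, $$pond(3n+2) \equiv 0 \pmod{2},$$ $$pond(27n+26) \equiv 0 \pmod{3},$$ and $$pond(3n+1) \equiv 0 \pmod{4}.$$
   Context: A POND partition is an integer partition in which the odd parts are not allowed to be distinct, i.e., no odd part appears with multiplicity exactly one (every odd part that occurs appears at least twice), while the even parts are unrestricted. For an integer $n\geq 0$, $pond(n)$ denotes the number of POND partitions of weight $n$, i.e., POND partitions whose parts sum to $n$ (the empty partition is counted, so $pond(0)=1$). *)

theory Defs
  imports "HOL-Library.Multiset" "HOL-Number_Theory.Cong"
begin

(* A partition of n is the multiset of its parts. *)
definition is_partition :: "nat \<Rightarrow> nat multiset \<Rightarrow> bool" where
  "is_partition n p \<longleftrightarrow> (\<forall>k \<in># p. k > 0) \<and> sum_mset p = n"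

definition is_pond :: "nat multiset \<Rightarrow> bool" where
  "is_pond p \<longleftrightarrow> (\<forall>k \<in># p. odd k \<longrightarrow> count p k \<ge> 2)"

definition pond :: "nat \<Rightarrow> nat" where
  "pond n = card {p. is_partition n p \<and> is_pond p}"

lemma is_partition_size_le:
  assumes "is_partition n p"
  shows "size p \<le> n"
proof -
  have "(\<forall>k \<in># p. k > 0) \<longrightarrow> size p \<le> sum_mset p" for p :: "nat multiset"
  proof (induction p)
    case empty
    then show ?case by simp
  next
    case (add x p)
    show ?case
    proof
      assume pos: "\<forall>k \<in># add_mset x p. k > 0"
      then have "x > 0" "size p \<le> sum_mset p" using add by simp_all
      then show "size (add_mset x p) \<le> sum_mset (add_mset x p)" by simp
    qed
  qed
  with assms show ?thesis by (auto simp: is_partition_def)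
qed

lemma is_partition_part_le:
  assumes "is_partition n p" "k \<in># p"
  shows "k \<le> n"
proof -
  have "n = k + sum_mset (p - {#k#})"
    using assms sum_mset.remove[of k p] by (simp add: is_partition_def)
  then show ?thesis by simp
qed

(* The sets counted by pond are finite, so card does not degenerate to 0. *)
lemma finite_partitions: "finite {p. is_partition n p}"
proof (rule finite_subset)
  show "{p. is_partition n p} \<subseteq> mset ` {xs. set xs \<subseteq> {..n} \<and> length xs \<le> n}"
  proof
    fix p assume "p \<in> {p. is_partition n p}"
    then have p: "is_partition n p" by simp
    obtain xs where xs: "mset xs = p" using ex_mset by blast
    have "set xs = set_mset p" "length xs = size p"
      using xs by (metis set_mset_mset, metis size_mset)
    then have "set xs \<subseteq> {..n}" "length xs \<le> n"
      using is_partition_part_le[OF p] is_partition_size_le[OF p] by auto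
    with xs show "p \<in> mset ` {xs. set xs \<subseteq> {..n} \<and> length xs \<le> n}" by blast
  qed
qed (intro finite_imageI finite_lists_length_le finite_atMost)

lemma finite_pond_partitions: "finite {p. is_partition n p \<and> is_pond p}"
  by (rule finite_subset[OF _ finite_partitions]) auto

lemma pond_0: "pond 0 = 1"
proof -
  have "{p. is_partition 0 p \<and> is_pond p} = {{#}}"
    using is_partition_size_le[of 0] by (auto simp: is_partition_def is_pond_def)
  then show ?thesis by (simp add: pond_def)
qed

end

theory Submission
  imports Defs "HOL-Computational_Algebra.Formal_Power_Series"
begin

text \<open>
  Write \<open>\<phi>(-q)\<close>, \<open>\<psi>(q)\<close> and \<open>\<Omega>(-q)\<close> for the sums over \<open>j \<in> \<int>\<close> of
  \<open>(-1)\<^sup>j q^(j\<^sup>2)\<close>, \<open>q^(2j\<^sup>2-j)\<close> and \<open>(-1)\<^sup>j q^(3j\<^sup>2-2j)\<close>, and \<open>A(q)\<close> for the product of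
  \<open>1 + q^m\<close> over odd \<open>m\<close>. An odd part \<open>m\<close> contributes
  \<open>1 + q^(2m)/(1 - q^m) = (1 + q^(3m))/(1 - q^(2m))\<close>, so the generating function of POND
  partitions is \<open>A(q\<^sup>3)/\<phi>(-q\<^sup>2)\<close>.

  The 3-dissection \<open>\<phi>(-q) = \<phi>(-q^9) - 2q \<Omega>(-q\<^sup>3)\<close> has the shape \<open>u - 2v\<close>; expanding
  \<open>1/(u - 2v) = (u\<^sup>2 + 2uv + 4v\<^sup>2)/(u\<^sup>3 - 8v\<^sup>3)\<close>, where the denominator is a series in \<open>q\<^sup>3\<close> (after
  \<open>q \<mapsto> q\<^sup>2\<close>), puts a factor 4 on the exponents \<open>3n + 1\<close> and a factor 2 on the exponents \<open>3n + 2\<close>.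

  Modulo 3, the same denominator is \<open>\<phi>(-q\<^sup>2)\<^sup>3\<close>, and by the product formulas for the theta functions
  the section \<open>3n + 2\<close> of the generating function is \<open>2 f\<^sub>6 f\<^sub>1\<^sub>2/\<psi>(-q)\<close>, where
  \<open>f\<^sub>k\<close> is the product of all \<open>1 - q^(ki)\<close>.
  Since \<open>1/\<psi>(-q)\<close> is congruent to \<open>\<psi>(-q)\<^sup>2/\<psi>(-q\<^sup>3)\<close>, a second section gives
  \<open>2 \<psi>(q) \<psi>(-q\<^sup>3)\<^sup>2\<close> for the exponents \<open>9n + 8\<close>. The exponents of \<open>\<psi>(q)\<close> are triangular numbers,
  which are never 2 modulo 3, so the section \<open>27n + 26\<close> vanishes modulo 3.
\<close>

subsection \<open>Divisibility of formal power series\<close>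

lemma fps_X_power_dvd_iff:
  fixes f :: "'a::comm_ring_1 fps"
  shows "fps_X ^ n dvd f \<longleftrightarrow> (\<forall>i<n. fps_nth f i = 0)"
proof
  assume "fps_X ^ n dvd f"
  then obtain g where "f = fps_X ^ n * g" by blast
  then show "\<forall>i<n. fps_nth f i = 0" by (simp add: fps_X_power_mult_nth)
next
  assume *: "\<forall>i<n. fps_nth f i = 0"
  have "f = fps_X ^ n * Abs_fps (\<lambda>i. fps_nth f (i + n))"
    by (rule fps_ext) (use * in \<open>auto simp: fps_X_power_mult_nth\<close>)
  then show "fps_X ^ n dvd f" by (metis dvd_triv_left)
qed

lemma fps_const_dvd_iff:
  fixes f :: "int fps"
  shows "fps_const c dvd f \<longleftrightarrow> (\<forall>n. c dvd fps_nth f n)"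
proof
  assume "fps_const c dvd f"
  then show "\<forall>n. c dvd fps_nth f n" by auto
next
  assume *: "\<forall>n. c dvd fps_nth f n"
  have "f = fps_const c * Abs_fps (\<lambda>n. fps_nth f n div c)"
    by (rule fps_ext) (use * in auto)
  then show "fps_const c dvd f" by (metis dvd_triv_left)
qed

text \<open>Divisibility of a difference is read as a congruence; these rules serve for truncation
  modulo powers of \<open>fps_X\<close> and for reduction modulo an integer constant.\<close>

lemma dvd_diff_mult:
  fixes a b c d m :: "'a::comm_ring_1"
  assumes "m dvd a - b" "m dvd c - d"
  shows "m dvd a * c - b * d"
proof -
  have "a * c - b * d = (a - b) * c + b * (c - d)" by (simp add: algebra_simps)
  then show ?thesis using assms by (metis dvd_add dvd_mult dvd_mult2)
qed

lemma dvd_diff_trans: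
  fixes a b c m :: "'a::comm_ring_1"
  assumes "m dvd a - b" "m dvd b - c"
  shows "m dvd a - c"
  using dvd_add[OF assms] by simp

lemma dvd_diff_sym:
  fixes a b m :: "'a::comm_ring_1"
  assumes "m dvd a - b"
  shows "m dvd b - a"
  using assms by (metis dvd_minus_iff minus_diff_eq)

text \<open>A series with constant term 1 is invertible over the integers, so Euler products and
  similar denominators can be cancelled from a divisibility.\<close>

lemma fps_unit_dvd:
  fixes u f g :: "int fps"
  assumes "fps_nth u 0 = 1" "g dvd u * f"
  shows "g dvd f"
proof -
  have "u * fps_right_inverse u 1 = 1"
    by (rule fps_right_inverse) (use assms in simp)
  then have "f = fps_right_inverse u 1 * (u * f)"
    by (simp add: mult.assoc[symmetric] mult.commute)
  then show ?thesis using assms(2) by (metis dvd_mult)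
qed

text \<open>Identities of infinite products are proved modulo every power of \<open>fps_X\<close>,
  where finite products suffice.\<close>

lemma fps_eqI_dvd:
  fixes f g :: "int fps"
  assumes "\<And>n. fps_X ^ n dvd f - g"
  shows "f = g"
proof (rule fps_ext)
  fix n show "fps_nth f n = fps_nth g n"
    using assms[of "Suc n"] unfolding fps_X_power_dvd_iff by auto
qed

subsection \<open>Infinite products\<close>

definition qfactor :: "int \<Rightarrow> nat \<Rightarrow> nat \<Rightarrow> nat \<Rightarrow> int fps" where
  "qfactor s a r k = 1 + fps_const s * fps_X ^ (a * k + r)"

text \<open>The infinite q-Pochhammer symbol (-s q^r; q^a). For \<open>a\<close>, \<open>r\<close>
  at least 1 the factor of index \<open>k\<close> agrees with 1 up to degree \<open>k\<close>, so
  the first \<open>Suc n\<close> factors settle coefficient \<open>n\<close>.\<close>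

definition qprod :: "int \<Rightarrow> nat \<Rightarrow> nat \<Rightarrow> int fps" where
  "qprod s a r = Abs_fps (\<lambda>n. fps_nth (\<Prod>k<Suc n. qfactor s a r k) n)"

lemma qfactor_prod_stable:
  assumes "a \<ge> 1" "r \<ge> 1" "N \<le> M"
  shows "fps_X ^ Suc N dvd (\<Prod>k<M. qfactor s a r k) - (\<Prod>k<N. qfactor s a r k)"
  using assms(3)
proof (induction M rule: dec_induct)
  case base
  then show ?case by simp
next
  case (step M)
  have "M \<le> a * M" using assms(1) by simp
  then have "Suc N \<le> a * M + r" using step.hyps assms(2) by linarith
  then have "(fps_X :: int fps) ^ Suc N dvd fps_X ^ (a * M + r)"
    by (rule le_imp_power_dvd)
  moreover have "(\<Prod>k<Suc M. qfactor s a r k) - (\<Prod>k<M. qfactor s a r k)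
     = fps_X ^ (a * M + r) * (fps_const s * (\<Prod>k<M. qfactor s a r k))"
    by (simp add: qfactor_def algebra_simps)
  ultimately have "fps_X ^ Suc N dvd (\<Prod>k<Suc M. qfactor s a r k) - (\<Prod>k<M. qfactor s a r k)"
    by (metis dvd_mult2)
  then show ?case using step.IH by (rule dvd_diff_trans)
qed

lemma qprod_approx:
  assumes "a \<ge> 1" "r \<ge> 1" "n \<le> Suc N"
  shows "fps_X ^ n dvd qprod s a r - (\<Prod>k<N. qfactor s a r k)"
  unfolding fps_X_power_dvd_iff
proof (intro allI impI)
  fix i assume i: "i < n"
  then have "i \<le> N" using assms by simp
  then have 1: "fps_nth (\<Prod>k<N. qfactor s a r k) i = fps_nth (\<Prod>k<i. qfactor s a r k) i"
    using qfactor_prod_stable[OF assms(1,2), of i N s] unfolding fps_X_power_dvd_iff by auto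
  have 2: "fps_nth (\<Prod>k<Suc i. qfactor s a r k) i = fps_nth (\<Prod>k<i. qfactor s a r k) i"
    using qfactor_prod_stable[OF assms(1,2), of i "Suc i" s] unfolding fps_X_power_dvd_iff by auto
  show "fps_nth (qprod s a r - (\<Prod>k<N. qfactor s a r k)) i = 0"
    using 1 2 by (simp add: qprod_def del: prod.lessThan_Suc)
qed

lemma qprod_nth_0: "a \<ge> 1 \<Longrightarrow> r \<ge> 1 \<Longrightarrow> fps_nth (qprod s a r) 0 = 1"
  by (simp add: qprod_def qfactor_def fps_X_power_mult_nth)

text \<open>Factor by factor this is \<open>(1 + x) * (1 - x) = 1 - x * x\<close>.\<close>

lemma qprod_conj:
  assumes "a \<ge> 1" "r \<ge> 1"
  shows "qprod 1 a r * qprod (- 1) a r = qprod (- 1) (2 * a) (2 * r)"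
proof (rule fps_eqI_dvd)
  fix n
  have "qfactor 1 a r k * qfactor (- 1) a r k = qfactor (- 1) (2 * a) (2 * r) k" for k
  proof -
    define x :: "int fps" where "x = fps_X ^ (a * k + r)"
    have "2 * a * k + 2 * r = (a * k + r) + (a * k + r)" by simp
    then have "fps_X ^ (2 * a * k + 2 * r) = x * x" unfolding x_def by (metis power_add)
    then show ?thesis
      unfolding qfactor_def x_def[symmetric]
      by (simp add: algebra_simps fps_const_neg[symmetric] del: fps_const_neg)
  qed
  then have eq: "(\<Prod>k<n. qfactor 1 a r k) * (\<Prod>k<n. qfactor (- 1) a r k)
     = (\<Prod>k<n. qfactor (- 1) (2 * a) (2 * r) k)"
    by (simp add: prod.distrib[symmetric])
  have "fps_X ^ n dvd qprod 1 a r * qprod (- 1) a r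
      - (\<Prod>k<n. qfactor 1 a r k) * (\<Prod>k<n. qfactor (- 1) a r k)"
    by (intro dvd_diff_mult qprod_approx) (use assms in auto)
  moreover have "fps_X ^ n dvd qprod (- 1) (2 * a) (2 * r) - (\<Prod>k<n. qfactor (- 1) (2 * a) (2 * r) k)"
    by (rule qprod_approx) (use assms in auto)
  ultimately show "fps_X ^ n dvd qprod 1 a r * qprod (- 1) a r - qprod (- 1) (2 * a) (2 * r)"
    unfolding eq using dvd_diff_trans dvd_diff_sym by blast
qed

lemma prod_lessThan_mult:
  fixes f :: "nat \<Rightarrow> 'a::comm_monoid_mult"
  shows "(\<Prod>k<n * m. f k) = (\<Prod>i<m. \<Prod>k<n. f (m * k + i))"
proof -
  have "(\<Prod>k<n * m. f k) = (\<Prod>k<n. prod f {k * m..<k * m + m})"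
    by (rule prod.nat_group[symmetric])
  also have "\<dots> = (\<Prod>k<n. \<Prod>i<m. f (m * k + i))"
    by (rule prod.cong[OF refl], subst prod.atLeastLessThan_shift_0)
       (simp add: lessThan_atLeast0 mult.commute add.commute)
  also have "\<dots> = (\<Prod>i<m. \<Prod>k<n. f (m * k + i))" by (rule prod.swap)
  finally show ?thesis .
qed

text \<open>Factors are sorted by the residue \<open>i\<close> of their index modulo
  \<open>m\<close>; the first \<open>n * m\<close> factors on the left match the first
  \<open>n\<close> of each product on the right.\<close>

lemma qprod_split:
  assumes "a \<ge> 1" "r \<ge> 1" "m \<ge> 1"
  shows "qprod s a r = (\<Prod>i<m. qprod s (m * a) (r + i * a))"
proof (rule fps_eqI_dvd)
  fix n
  have *: "fps_X ^ n dvd (\<Prod>i<l. qprod s (m * a) (r + i * a))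
      - (\<Prod>i<l. \<Prod>k<n. qfactor s (m * a) (r + i * a) k)" for l
  proof (induction l)
    case (Suc l)
    then show ?case
      unfolding prod.lessThan_Suc
      by (intro dvd_diff_mult qprod_approx) (use assms in auto)
  qed simp
  have "qfactor s (m * a) (r + i * a) k = qfactor s a r (m * k + i)" for i k
    by (simp add: qfactor_def algebra_simps)
  then have "(\<Prod>k<n * m. qfactor s a r k) = (\<Prod>i<m. \<Prod>k<n. qfactor s (m * a) (r + i * a) k)"
    by (simp add: prod_lessThan_mult)
  moreover have "fps_X ^ n dvd qprod s a r - (\<Prod>k<n * m. qfactor s a r k)"
    by (rule qprod_approx) (use assms in \<open>auto intro: le_SucI\<close>)
  ultimately show "fps_X ^ n dvd qprod s a r - (\<Prod>i<m. qprod s (m * a) (r + i * a))"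
    using * dvd_diff_trans dvd_diff_sym by metis
qed

subsection \<open>The Jacobi triple product\<close>

fun qbin :: "'a::comm_ring_1 \<Rightarrow> nat \<Rightarrow> nat \<Rightarrow> 'a" where
  "qbin q n 0 = 1"
| "qbin q 0 (Suc i) = 0"
| "qbin q (Suc n) (Suc i) = qbin q n i + q ^ Suc i * qbin q n (Suc i)"

lemma qbin_eq_0: "n < i \<Longrightarrow> qbin q n i = 0"
  by (induction q n i rule: qbin.induct) auto

lemma qbin_self: "qbin q n n = 1"
  by (induction n) (auto simp: qbin_eq_0)

text \<open>The quotient formula for Gaussian binomials, cleared of denominators. In the double
  induction the q-Pascal rule yields two terms, whose weights add up to the last factor of the
  right-hand product.\<close>

lemma qbin_mult_qpochhammer:
  fixes q :: "'a::comm_ring_1"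
  shows "qbin q (m + n) m * (\<Prod>k<m. 1 - q ^ Suc k) * (\<Prod>k<n. 1 - q ^ Suc k)
    = (\<Prod>k<m + n. 1 - q ^ Suc k)"
proof (induction m arbitrary: n)
  case (Suc m)
  show ?case
  proof (induction n)
    case 0
    then show ?case by (simp add: qbin_self qbin_eq_0 del: power_Suc)
  next
    case (Suc n)
    let ?P = "\<lambda>m. \<Prod>k<m. 1 - q ^ Suc k"
    \<comment> \<open>The induction hypothesis of the outer induction, taken at
      \<open>Suc n\<close>.\<close>
    have 1: "qbin q (Suc m + n) m * ?P m * ?P (Suc n) = ?P (Suc m + n)"
      using Suc.prems Suc.IH \<open>\<And>n. qbin q (m + n) m * ?P m * ?P n = ?P (m + n)\<close>[of "Suc n"]
      by simp
    have "qbin q (Suc m + Suc n) (Suc m) * ?P (Suc m) * ?P (Suc n)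
      = (1 - q ^ Suc m) * (qbin q (Suc m + n) m * ?P m * ?P (Suc n))
      + q ^ Suc m * (1 - q ^ Suc n) * (qbin q (Suc m + n) (Suc m) * ?P (Suc m) * ?P n)"
      by (simp add: algebra_simps del: power_Suc)
    also have "\<dots> = ((1 - q ^ Suc m) + q ^ Suc m * (1 - q ^ Suc n)) * ?P (Suc m + n)"
      unfolding 1 Suc.IH by (simp add: algebra_simps)
    also have "(1 - q ^ Suc m) + q ^ Suc m * (1 - q ^ Suc n) = 1 - q ^ Suc (Suc m + n)"
      by (simp add: algebra_simps power_add)
    finally show ?case by (simp add: mult.commute del: power_Suc)
  qed
qed simp

lemma choose_two_Suc: "Suc i choose 2 = (i choose 2) + i"
  by (simp add: numeral_2_eq_2)

text \<open>Splitting off the factor \<open>k = 0\<close> replaces \<open>x\<close> by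
  \<open>x * q\<close>, so \<open>x\<close> varies in the induction. The homogeneous form with
  \<open>y\<close> allows a symmetric specialisation without negative powers of
  \<open>q\<close>.\<close>

lemma q_binomial_theorem:
  fixes q x y :: "'a::comm_ring_1"
  shows "(\<Prod>k<n. y + x * q ^ k) = (\<Sum>i\<le>n. q ^ (i choose 2) * qbin q n i * x ^ i * y ^ (n - i))"
proof (induction n arbitrary: x)
  case 0
  then show ?case by (simp add: numeral_2_eq_2)
next
  case (Suc n)
  define h where "h = (\<lambda>i. q ^ (i choose 2) * qbin q n i * (x * q) ^ i)"
  have "(\<Prod>k<Suc n. y + x * q ^ k) = (y + x) * (\<Prod>k<n. y + (x * q) * q ^ k)"
    by (subst prod.lessThan_Suc_shift) (simp add: mult.assoc)
  also have "\<dots> = y * (\<Sum>i\<le>n. h i * y ^ (n - i)) + x * (\<Sum>i\<le>n. h i * y ^ (n - i))"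
    by (simp add: Suc.IH h_def distrib_right)
  also have "y * (\<Sum>i\<le>n. h i * y ^ (n - i)) = (\<Sum>i\<le>n. h i * y ^ (Suc n - i))"
    unfolding sum_distrib_left by (rule sum.cong) (auto simp: Suc_diff_le mult_ac)
  \<comment> \<open>The added term is zero because \<open>qbin q n (Suc n) = 0\<close>; it makes the
    index shift possible.\<close>
  also have "\<dots> = (\<Sum>i\<le>Suc n. h i * y ^ (Suc n - i))"
    by (simp add: h_def qbin_eq_0)
  also have "\<dots> = y ^ Suc n + (\<Sum>i\<le>n. h (Suc i) * y ^ (n - i))"
    by (subst sum.atMost_Suc_shift) (simp add: h_def numeral_2_eq_2)
  also have "x * (\<Sum>i\<le>n. h i * y ^ (n - i)) = (\<Sum>i\<le>n. x * h i * y ^ (n - i))"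
    by (simp add: sum_distrib_left mult.assoc)
  also have "y ^ Suc n + (\<Sum>i\<le>n. h (Suc i) * y ^ (n - i)) + (\<Sum>i\<le>n. x * h i * y ^ (n - i))
    = y ^ Suc n + (\<Sum>i\<le>n. (h (Suc i) + x * h i) * y ^ (n - i))"
    by (simp add: sum.distrib distrib_right)
  also have "\<dots> = y ^ Suc n + (\<Sum>i\<le>n. q ^ (Suc i choose 2) * qbin q (Suc n) (Suc i) * x ^ Suc i * y ^ (n - i))"
    by (simp add: h_def choose_two_Suc power_add power_mult_distrib algebra_simps)
  also have "\<dots> = (\<Sum>i\<le>Suc n. q ^ (i choose 2) * qbin q (Suc n) i * x ^ i * y ^ (Suc n - i))"
    by (subst sum.atMost_Suc_shift) (simp add: numeral_2_eq_2)
  finally show ?case .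
qed

section \<open>The finite triple product\<close>

lemma prod_pow_choose_two: "(\<Prod>k<n. q ^ k) = (q :: 'a::comm_monoid_mult) ^ (n choose 2)"
  by (induction n) (simp_all add: choose_two_Suc power_add binomial_eq_0 del: binomial_Suc_Suc)

lemma prod_lessThan_add:
  fixes f :: "nat \<Rightarrow> 'a::comm_monoid_mult"
  shows "(\<Prod>k<m + n. f k) = (\<Prod>k<m. f k) * (\<Prod>k<n. f (k + m))"
  by (induction n) (auto simp: mult_ac add_ac)

text \<open>The exponent of the term of index \<open>j\<close> in Ramanujan's theta function f(q^a,
  q^b); both halves are exact.\<close>

definition jexp :: "nat \<Rightarrow> nat \<Rightarrow> int \<Rightarrow> int" where
  "jexp a b j = int a * (j * (j + 1) div 2) + int b * (j * (j - 1) div 2)"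

lemma two_jexp: "2 * jexp a b j = int a * (j * (j + 1)) + int b * (j * (j - 1))"
proof -
  have "even (j * (j + 1))" "even (j * (j - 1))" by auto
  then have "2 * (j * (j + 1) div 2) = j * (j + 1)" "2 * (j * (j - 1) div 2) = j * (j - 1)"
    by (simp_all only: dvd_mult_div_cancel)
  then show ?thesis unfolding jexp_def
    by (metis (no_types, lifting) distrib_left mult.left_commute)
qed

text \<open>Twice the exponent is at least j(j+1) + j(j-1) = 2j^2. The bound makes
  \<open>nat\<close> harmless on exponents and leaves only finitely many \<open>j\<close> for each
  degree.\<close>

lemma jexp_ge:
  assumes "a \<ge> 1" "b \<ge> 1"
  shows "\<bar>j\<bar> \<le> jexp a b j"
proof -
  have 1: "j * (j + 1) \<ge> 0" "j * (j - 1) \<ge> 0"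
    by (auto simp: zero_le_mult_iff)
  have "1 * (j * (j + 1)) \<le> int a * (j * (j + 1))" "1 * (j * (j - 1)) \<le> int b * (j * (j - 1))"
    using 1 assms by (intro mult_right_mono; simp)+
  moreover have "j * (j + 1) + j * (j - 1) = 2 * (j * j)" by (simp add: algebra_simps)
  moreover have "\<bar>j\<bar> \<le> j * j" using 1 by (simp add: abs_if algebra_simps)
  ultimately show ?thesis using two_jexp[of a b j] by linarith
qed

lemma two_choose_two: "2 * int (n choose 2) = int n * (int n - 1)"
  by (induction n) (simp_all add: choose_two_Suc binomial_eq_0 algebra_simps del: binomial_Suc_Suc)

text \<open>The \<open>q\<close>-binomial theorem at \<open>x = \<alpha>\<close>, \<open>y = Q\<^sup>N\<close> with \<open>2 * N\<close> factors, where
  \<open>\<alpha> = s X\<^sup>a\<close>, \<open>\<beta> = s X\<^sup>b\<close>, \<open>Q = \<alpha> \<beta>\<close>: the first half of the factors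
  turns into the \<open>\<beta>\<close>-product because \<open>Q = \<alpha> \<beta>\<close>.\<close>

lemma finite_jacobi_triple_product:
  fixes s :: int
  assumes s: "s * s = 1" and ab: "a \<ge> 1" "b \<ge> 1"
  shows "(\<Prod>k<N. qfactor s (a + b) a k) * (\<Prod>k<N. qfactor s (a + b) b k)
    = (\<Sum>i\<le>2 * N. fps_const (s ^ (i + N)) * fps_X ^ nat (jexp a b (int i - int N))
        * qbin (fps_X ^ (a + b)) (2 * N) i)"
proof -
  define S :: "int fps" where "S = fps_const s"
  define Q :: "int fps" where "Q = fps_X ^ (a + b)"
  define u where "u = S * fps_X ^ a"
  define v where "v = S * fps_X ^ b"
  have S: "S * S = 1" using s by (simp add: S_def)
  have uv: "u * v = Q"
  proof -
    have "u * v = (S * S) * fps_X ^ (a + b)" by (simp add: u_def v_def power_add mult_ac)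
    then show ?thesis by (simp add: S Q_def)
  qed
  \<comment> \<open>The monomial common to both evaluations: \<open>Q ^ (N choose 2) * u ^ N\<close>
    comes from the first half of the factors, \<open>Q ^ (N * N)\<close> from the second. It is
    nonzero and is cancelled at the end.\<close>
  define W where "W = Q ^ (N choose 2) * Q ^ (N * N) * u ^ N"
  have W: "W = S ^ N * fps_X ^ ((a + b) * (N choose 2) + (a + b) * (N * N) + a * N)"
    unfolding W_def Q_def u_def
    by (simp add: power_mult_distrib power_mult[symmetric] power_add[symmetric] mult_ac add_ac)
  have S0: "S \<noteq> 0" using S by auto
  have W0: "W \<noteq> 0" using S0 by (simp add: W_def Q_def u_def)
  have faca: "qfactor s (a + b) a k = 1 + u * Q ^ k" for k
    unfolding qfactor_def u_def Q_def S_def power_add[of fps_X "(a + b) * k"] power_mult by (simp add: mult_ac)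
  have facb: "qfactor s (a + b) b k = 1 + v * Q ^ k" for k
    unfolding qfactor_def v_def Q_def S_def power_add[of fps_X "(a + b) * k"] power_mult by (simp add: mult_ac)
  have "(\<Prod>k<2 * N. Q ^ N + u * Q ^ k)
      = (\<Prod>k<N. Q ^ N + u * Q ^ k) * (\<Prod>k<N. Q ^ N + u * Q ^ (k + N))"
    by (simp only: mult_2 prod_lessThan_add)
  also have "(\<Prod>k<N. Q ^ N + u * Q ^ (k + N)) = (\<Prod>k<N. Q ^ N * (1 + u * Q ^ k))"
    by (simp add: algebra_simps power_add)
  also have "\<dots> = Q ^ (N * N) * (\<Prod>k<N. 1 + u * Q ^ k)"
    by (simp add: prod.distrib power_mult)
  also have "(\<Prod>k<N. Q ^ N + u * Q ^ k) = (\<Prod>k<N. Q ^ N + u * Q ^ (N - Suc k))"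
    by (rule prod.nat_diff_reindex[symmetric])
  also have "\<dots> = (\<Prod>k<N. u * Q ^ (N - Suc k) * (1 + v * Q ^ k))"
  proof (rule prod.cong[OF refl])
    fix k assume "k \<in> {..<N}"
    then have "N = Suc (N - Suc k + k)" by simp
    then have "Q ^ N = Q * (Q ^ (N - Suc k) * Q ^ k)"
      by (metis power_Suc power_add)
    then have "Q ^ N = u * v * (Q ^ (N - Suc k) * Q ^ k)" unfolding uv .
    then show "Q ^ N + u * Q ^ (N - Suc k) = u * Q ^ (N - Suc k) * (1 + v * Q ^ k)"
      by (simp add: algebra_simps)
  qed
  also have "\<dots> = u ^ N * (\<Prod>k<N. Q ^ (N - Suc k)) * (\<Prod>k<N. 1 + v * Q ^ k)"
    by (simp add: prod.distrib)
  also have "(\<Prod>k<N. Q ^ (N - Suc k)) = Q ^ (N choose 2)"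
    by (simp only: prod.nat_diff_reindex prod_pow_choose_two)
  finally have L: "(\<Prod>k<2 * N. Q ^ N + u * Q ^ k)
      = W * ((\<Prod>k<N. qfactor s (a + b) a k) * (\<Prod>k<N. qfactor s (a + b) b k))"
    by (simp add: W_def faca facb mult_ac)
  have "(\<Prod>k<2 * N. Q ^ N + u * Q ^ k)
    = (\<Sum>i\<le>2 * N. Q ^ (i choose 2) * qbin Q (2 * N) i * u ^ i * (Q ^ N) ^ (2 * N - i))"
    by (rule q_binomial_theorem)
  also have "\<dots> = (\<Sum>i\<le>2 * N. W * (fps_const (s ^ (i + N)) * fps_X ^ nat (jexp a b (int i - int N))
        * qbin Q (2 * N) i))"
  proof (rule sum.cong[OF refl])
    fix i assume "i \<in> {..2 * N}"
    then have i: "i \<le> 2 * N" by simp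
    define e where "e = nat (jexp a b (int i - int N))"
    have e: "2 * int e = int a * ((int i - int N) * (int i - int N + 1)) + int b * ((int i - int N) * (int i - int N - 1))"
      unfolding e_def using jexp_ge[OF ab, of "int i - int N"] two_jexp[of a b "int i - int N"] by simp
    have cancel: "x = y" if "2 * int x = 2 * int y" for x y using that by simp
    \<comment> \<open>Doubling turns the binomial coefficients and \<open>jexp\<close> into integer
      polynomials, which ring arithmetic can compare.\<close>
    have "2 * int ((a + b) * (i choose 2) + a * i + (a + b) * (N * (2 * N - i)))
      = int (a + b) * (2 * int (i choose 2)) + 2 * int a * int i + 2 * int (a + b) * (int N * (2 * int N - int i))"
    proof -
      define m where "m = 2 * N - i"
      have "2 * int N - int i = int m" using i by (simp add: m_def)
      then show ?thesis unfolding m_def[symmetric] by (simp add: algebra_simps)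
    qed
    also have "\<dots> = int (a + b) * (2 * int (N choose 2)) + 2 * int (a + b) * (int N * int N) + 2 * int a * int N + 2 * int e"
      unfolding two_choose_two e by (simp add: algebra_simps)
    also have "\<dots> = 2 * int ((a + b) * (N choose 2) + (a + b) * (N * N) + a * N + e)"
      by (simp add: algebra_simps)
    finally have ex: "(a + b) * (i choose 2) + a * i + (a + b) * (N * (2 * N - i))
       = (a + b) * (N choose 2) + (a + b) * (N * N) + a * N + e" by (rule cancel)
    have SS: "S ^ N * S ^ (i + N) = S ^ i"
    proof -
      have "S ^ N * S ^ (i + N) = S ^ i * (S * S) ^ N"
        by (simp add: power_add power_mult_distrib mult_ac)
      then show ?thesis by (simp add: S)
    qed
    have "Q ^ (i choose 2) * u ^ i * (Q ^ N) ^ (2 * N - i)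
      = S ^ i * fps_X ^ ((a + b) * (i choose 2) + a * i + (a + b) * (N * (2 * N - i)))"
      unfolding Q_def u_def by (simp add: power_mult_distrib power_mult[symmetric] power_add[symmetric] mult_ac add_ac)
    also have "\<dots> = S ^ N * S ^ (i + N) * fps_X ^ ((a + b) * (N choose 2) + (a + b) * (N * N) + a * N + e)"
      unfolding ex SS ..
    also have "\<dots> = W * (S ^ (i + N) * fps_X ^ e)"
      unfolding W power_add[of _ _ e] by (simp only: mult_ac)
    finally have "Q ^ (i choose 2) * u ^ i * (Q ^ N) ^ (2 * N - i) = W * (S ^ (i + N) * fps_X ^ e)" .
    note term_eq = this
    have "Q ^ (i choose 2) * qbin Q (2 * N) i * u ^ i * (Q ^ N) ^ (2 * N - i)
      = Q ^ (i choose 2) * u ^ i * (Q ^ N) ^ (2 * N - i) * qbin Q (2 * N) i"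
      by (simp only: mult_ac)
    also have "\<dots> = W * (fps_const (s ^ (i + N)) * fps_X ^ e * qbin Q (2 * N) i)"
      unfolding term_eq by (simp add: S_def fps_const_power mult.assoc)
    finally show "Q ^ (i choose 2) * qbin Q (2 * N) i * u ^ i * (Q ^ N) ^ (2 * N - i)
      = W * (fps_const (s ^ (i + N)) * fps_X ^ nat (jexp a b (int i - int N)) * qbin Q (2 * N) i)"
      unfolding e_def .
  qed
  finally show ?thesis unfolding L sum_distrib_left[symmetric] using W0 by (simp add: Q_def)
qed

text \<open>The Gaussian binomial tends to the reciprocal of the Euler product \<open>?E\<close>: in
  the quotient formula all three finite products are replaced by \<open>?E\<close>, and one copy of
  \<open>?E\<close> is cancelled.\<close>

lemma qbin_approx:
  assumes "c \<ge> 1" "i \<le> 2 * N" "n \<le> Suc i" "n \<le> Suc (2 * N - i)"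
  shows "fps_X ^ n dvd qbin (fps_X ^ c) (2 * N) i * qprod (- 1) c c - 1"
proof -
  let ?E = "qprod (- 1) c c" and ?P = "\<lambda>m. \<Prod>k<m. qfactor (- 1) c c k"
  let ?B = "qbin (fps_X ^ c :: int fps) (2 * N) i"
  have f: "qfactor (- 1) c c k = 1 - (fps_X ^ c) ^ Suc k" for k
    by (simp add: qfactor_def power_mult[symmetric] power_add[symmetric] add.commute
        fps_const_neg[symmetric] del: fps_const_neg)
  have eq: "?B * ?P i * ?P (2 * N - i) = ?P (2 * N)"
    using qbin_mult_qpochhammer[of "fps_X ^ c :: int fps" i "2 * N - i"] assms(2) by (simp add: f del: power_Suc)
  have "fps_X ^ n dvd ?B * ?E * ?E - ?B * ?P i * ?P (2 * N - i)"
    by (intro dvd_diff_mult qprod_approx) (use assms in auto)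
  moreover have "fps_X ^ n dvd ?E - ?P (2 * N)"
    by (rule qprod_approx) (use assms in auto)
  ultimately have "fps_X ^ n dvd ?B * ?E * ?E - ?E"
    unfolding eq using dvd_diff_trans dvd_diff_sym by blast
  then have "fps_X ^ n dvd ?E * (?B * ?E - 1)" by (simp add: algebra_simps)
  then show ?thesis by (rule fps_unit_dvd[rotated]) (use assms in \<open>auto simp: qprod_nth_0\<close>)
qed

text \<open>The finite form is multiplied by \<open>?E\<close>, which removes the Gaussian binomials
  up to an error beyond the degree in question.\<close>

theorem jacobi_triple_product:
  fixes s :: int
  assumes s: "s * s = 1" and ab: "a \<ge> 1" "b \<ge> 1"
  shows "fps_nth (qprod s (a + b) a * qprod s (a + b) b * qprod (- 1) (a + b) (a + b)) n
    = (\<Sum>j | jexp a b j = int n. if even j then 1 else s)"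
proof -
  \<comment> \<open>Coefficient \<open>n\<close> then lies below the truncation degree
    \<open>N\<close>, and every \<open>j\<close> with exponent \<open>n\<close> has
    \<open>j + N\<close> between 0 and \<open>2 * N\<close>.\<close>
  define N where "N = Suc n"
  define e where "e = (\<lambda>i. nat (jexp a b (int i - int N)))"
  let ?E = "qprod (- 1) (a + b) (a + b)"
  let ?t = "\<lambda>i. fps_const (s ^ (i + N)) * fps_X ^ e i"
  let ?B = "qbin (fps_X ^ (a + b)) (2 * N)"
  have "fps_X ^ N dvd qprod s (a + b) a * qprod s (a + b) b * ?E
     - (\<Prod>k<N. qfactor s (a + b) a k) * (\<Prod>k<N. qfactor s (a + b) b k) * ?E"
    by (intro dvd_diff_mult qprod_approx) (use ab in auto)
  also have "(\<Prod>k<N. qfactor s (a + b) a k) * (\<Prod>k<N. qfactor s (a + b) b k) * ?E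
     = (\<Sum>i\<le>2 * N. ?t i * (?B i * ?E))"
    unfolding finite_jacobi_triple_product[OF assms] sum_distrib_right e_def by (simp add: mult.assoc)
  finally have 1: "fps_X ^ N dvd qprod s (a + b) a * qprod s (a + b) b * ?E
     - (\<Sum>i\<le>2 * N. ?t i * (?B i * ?E))" .
  have "fps_X ^ N dvd (\<Sum>i\<le>2 * N. ?t i * (?B i * ?E)) - (\<Sum>i\<le>2 * N. ?t i)"
    unfolding sum_subtractf[symmetric]
  proof (rule dvd_sum)
    fix i assume "i \<in> {..2 * N}"
    then have i: "i \<le> 2 * N" by simp
    define l where "l = min i (2 * N - i)"
    have "fps_X ^ l dvd ?B i * ?E - 1"
      by (rule qbin_approx) (use ab i in \<open>auto simp: l_def\<close>)
    then have "fps_X ^ (e i + l) dvd ?t i * (?B i * ?E - 1)"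
      unfolding power_add by (intro mult_dvd_mono) auto
    \<comment> \<open>Far from the centre the binomial is approximated badly, but the monomial has
      high degree: \<open>e i\<close> is at least the distance from \<open>i\<close> to
      \<open>N\<close>, and that distance plus \<open>l\<close> is \<open>N\<close>.\<close>
    moreover have "N \<le> e i + l"
      using jexp_ge[OF ab, of "int i - int N"] i unfolding l_def e_def by linarith
    ultimately have "fps_X ^ N dvd ?t i * (?B i * ?E - 1)"
      using le_imp_power_dvd dvd_trans by blast
    then show "fps_X ^ N dvd ?t i * (?B i * ?E) - ?t i" by (simp add: algebra_simps)
  qed
  from dvd_diff_trans[OF 1 this]
  have "fps_nth (qprod s (a + b) a * qprod s (a + b) b * ?E) n = fps_nth (\<Sum>i\<le>2 * N. ?t i) n"
    unfolding fps_X_power_dvd_iff N_def by auto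
  also have "\<dots> = (\<Sum>i\<le>2 * N. if n = e i then s ^ (i + N) else 0)"
    by (simp add: fps_sum_nth if_distrib cong: if_cong)
  also have "\<dots> = (\<Sum>i | i \<in> {..2 * N} \<and> n = e i. s ^ (i + N))"
    by (rule sum.inter_filter[symmetric]) simp
  also have "\<dots> = (\<Sum>j | jexp a b j = int n. if even j then 1 else s)"
  proof (rule sum.reindex_bij_witness[of _ "\<lambda>j. nat (j + int N)" "\<lambda>i. int i - int N"])
    fix j assume "j \<in> {j. jexp a b j = int n}"
    then have "\<bar>j\<bar> \<le> int n" "jexp a b j = int n" using jexp_ge[OF ab, of j] by auto
    then show "nat (j + int N) \<in> {i. i \<in> {..2 * N} \<and> n = e i}" "int (nat (j + int N)) - int N = j"
      by (auto simp: N_def e_def)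
  next
    fix i assume i: "i \<in> {i. i \<in> {..2 * N} \<and> n = e i}"
    then show "nat (int i - int N + int N) = i" by simp
    show "int i - int N \<in> {j. jexp a b j = int n}"
      using i jexp_ge[OF ab, of "int i - int N"] by (auto simp: e_def)
    have "s ^ (i + N) = (if even (i + N) then 1 else s)"
      using s by (cases "even (i + N)")
        (auto elim!: evenE oddE simp: power_mult power2_eq_square simp del: even_add odd_add)
    then show "(if even (int i - int N) then 1 else s) = s ^ (i + N)" by simp
  qed
  finally show ?thesis .
qed

subsection \<open>The generating function\<close>

text \<open>The exponent is the total weight of the parts equal to \<open>k\<close>; weight exactly
  \<open>k\<close> means multiplicity one.\<close>

definition pond_factor :: "nat \<Rightarrow> int fps" where
  "pond_factor k = Abs_fps (\<lambda>m. if k dvd m \<and> (odd k \<longrightarrow> m \<noteq> k) then 1 else 0)"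

definition pond_upto :: "nat \<Rightarrow> nat \<Rightarrow> nat multiset set" where
  "pond_upto N n = {p. set_mset p \<subseteq> {1..N} \<and> sum_mset p = n \<and> is_pond p}"

lemma pond_upto_eq:
  assumes "n \<le> N"
  shows "pond_upto N n = {p. is_partition n p \<and> is_pond p}"
proof -
  have "set_mset p \<subseteq> {1..N} \<and> sum_mset p = n \<longleftrightarrow> is_partition n p" for p
  proof
    assume "set_mset p \<subseteq> {1..N} \<and> sum_mset p = n"
    then show "is_partition n p" by (auto simp: is_partition_def subset_eq Suc_le_eq)
  next
    assume p: "is_partition n p"
    then have "0 < k" "k \<le> N" if "k \<in># p" for k
      using is_partition_part_le[OF p that] that assms by (auto simp: is_partition_def)
    then show "set_mset p \<subseteq> {1..N} \<and> sum_mset p = n"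
      using p by (auto simp: is_partition_def Suc_le_eq)
  qed
  then show ?thesis unfolding pond_upto_def by blast
qed

lemma finite_pond_upto: "finite (pond_upto N n)"
proof (rule finite_subset[OF _ finite_partitions[of n]])
  show "pond_upto N n \<subseteq> {p. is_partition n p}"
    unfolding pond_upto_def is_partition_def by (auto simp: subset_eq Suc_le_eq)
qed

lemma is_pond_add_replicate:
  assumes "k \<notin># p"
  shows "is_pond (p + replicate_mset m k) \<longleftrightarrow> is_pond p \<and> (odd k \<longrightarrow> m \<noteq> 1)"
proof -
  have "count p k = 0" using assms by (simp add: count_eq_zero_iff)
  then show ?thesis
    using assms unfolding is_pond_def by (auto split: if_splits)
qed

text \<open>A partition is cut into its parts \<open>Suc N\<close> and the rest \<open>p\<close> of
  weight \<open>i\<close>; the multiplicity of \<open>Suc N\<close> is recovered from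
  \<open>n - i\<close>, so the cut is a bijection.\<close>

lemma card_pond_upto_Suc:
  "card (pond_upto (Suc N) n)
    = (\<Sum>i | i \<le> n \<and> fps_nth (pond_factor (Suc N)) (n - i) = 1. card (pond_upto N i))"
proof -
  let ?K = "Suc N"
  let ?I = "{i. i \<le> n \<and> fps_nth (pond_factor ?K) (n - i) = 1}"
  define f where "f = (\<lambda>(i, p). p + replicate_mset ((n - i) div ?K) ?K)"
  define g where "g = (\<lambda>q. (n - count q ?K * ?K, filter_mset (\<lambda>x. x \<noteq> ?K) q))"
  have I: "i \<in> ?I \<longleftrightarrow> i \<le> n \<and> ?K dvd n - i \<and> (odd ?K \<longrightarrow> (n - i) div ?K \<noteq> 1)" for i
  proof -
    have "m div ?K = 1 \<longleftrightarrow> m = ?K" if "?K dvd m" for m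
      using that by (metis div_self dvd_mult_div_cancel mult.right_neutral nat.distinct(1))
    then show ?thesis by (auto simp: pond_factor_def)
  qed
  have split: "q = filter_mset (\<lambda>x. x \<noteq> ?K) q + replicate_mset (count q ?K) ?K" for q :: "nat multiset"
    by (rule multiset_eqI) auto
  have "bij_betw f (SIGMA i:?I. pond_upto N i) (pond_upto ?K n)"
  proof (rule bij_betw_byWitness[of _ g])
    show "\<forall>x\<in>SIGMA i:?I. pond_upto N i. g (f x) = x"
    proof
      fix x assume x: "x \<in> (SIGMA i:?I. pond_upto N i)"
      obtain i p where ip: "x = (i, p)" by (cases x)
      have p: "set_mset p \<subseteq> {1..N}" and i: "i \<in> ?I" using x ip by (auto simp: pond_upto_def)
      then have "?K \<notin># p" by auto
      then have "count p ?K = 0" "filter_mset (\<lambda>x. x \<noteq> ?K) p = p"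
        by (auto simp: count_eq_zero_iff filter_mset_eq_conv)
      moreover have "(n - i) div ?K * ?K = n - i" using i I by (metis dvd_div_mult_self)
      moreover have "i \<le> n" using i by simp
      ultimately show "g (f x) = x" by (simp add: ip f_def g_def del: mult_Suc_right)
    qed
    show "\<forall>q\<in>pond_upto ?K n. f (g q) = q"
    proof
      fix q assume q: "q \<in> pond_upto ?K n"
      have "sum_mset q = sum_mset (filter_mset (\<lambda>x. x \<noteq> ?K) q) + count q ?K * ?K"
        by (subst split) (simp add: sum_mset_replicate_mset)
      then have "count q ?K * ?K \<le> n" using q by (simp add: pond_upto_def)
      then have "(n - (n - count q ?K * ?K)) div ?K = count q ?K"
        by (simp del: mult_Suc_right)
      then show "f (g q) = q" using split[of q] by (simp add: f_def g_def del: mult_Suc_right)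
    qed
    show "f ` (SIGMA i:?I. pond_upto N i) \<subseteq> pond_upto ?K n"
    proof
      fix q assume "q \<in> f ` (SIGMA i:?I. pond_upto N i)"
      then obtain i p where i: "i \<in> ?I" and p: "p \<in> pond_upto N i" and q: "q = f (i, p)" by auto
      have sub: "set_mset p \<subseteq> {1..N}" using p by (simp add: pond_upto_def)
      then have "?K \<notin># p" by auto
      moreover have "(n - i) div ?K * ?K = n - i" using i I by (metis dvd_div_mult_self)
      ultimately show "q \<in> pond_upto ?K n"
        using p i sub I[of i] unfolding q f_def
        by (auto simp: pond_upto_def is_pond_add_replicate sum_mset_replicate_mset
            simp del: mult_Suc_right split: if_splits)
    qed
    show "g ` pond_upto ?K n \<subseteq> (SIGMA i:?I. pond_upto N i)"
    proof
      fix x assume "x \<in> g ` pond_upto ?K n"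
      then obtain q where q: "q \<in> pond_upto ?K n" and x: "x = g q" by auto
      define p where "p = filter_mset (\<lambda>x. x \<noteq> ?K) q"
      define m where "m = count q ?K"
      have qpm: "q = p + replicate_mset m ?K" unfolding p_def m_def by (rule split)
      have K: "?K \<notin># p" by (simp add: p_def)
      have n: "n = sum_mset p + m * ?K"
        using q unfolding qpm by (simp add: pond_upto_def sum_mset_replicate_mset)
      have "is_pond p" "odd ?K \<longrightarrow> m \<noteq> 1"
        using q is_pond_add_replicate[OF K, of m] unfolding qpm by (auto simp: pond_upto_def)
      moreover have "set_mset p \<subseteq> {1..N}"
      proof
        fix y assume y: "y \<in># p"
        then have "y \<in># q" "y \<noteq> ?K" by (auto simp: p_def)
        then show "y \<in> {1..N}" using q by (force simp: pond_upto_def)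
      qed
      moreover have "n - m * ?K = sum_mset p" "n - (n - m * ?K) = m * ?K" using n by auto
      ultimately have "p \<in> pond_upto N (n - m * ?K)" "n - m * ?K \<in> ?I"
        unfolding I by (auto simp: pond_upto_def simp del: mult_Suc_right)
      then show "x \<in> (SIGMA i:?I. pond_upto N i)"
        unfolding x g_def p_def m_def by auto
    qed
  qed
  then have "card (pond_upto ?K n) = card (SIGMA i:?I. pond_upto N i)"
    by (simp add: bij_betw_same_card)
  also have "\<dots> = (\<Sum>i\<in>?I. card (pond_upto N i))"
    by (rule card_SigmaI) (auto simp: finite_pond_upto)
  finally show ?thesis .
qed

lemma fps_nth_prod_pond_factor:
  "fps_nth (\<Prod>k<N. pond_factor (Suc k)) n = int (card (pond_upto N n))"
proof (induction N arbitrary: n)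
  case 0
  have "pond_upto 0 n = (if n = 0 then {{#}} else {})" by (auto simp: pond_upto_def is_pond_def)
  then show ?case by simp
next
  case (Suc N)
  have v: "fps_nth (pond_factor (Suc N)) m = (if fps_nth (pond_factor (Suc N)) m = 1 then 1 else 0)" for m
    by (simp add: pond_factor_def)
  have "fps_nth (\<Prod>k<Suc N. pond_factor (Suc k)) n
      = (\<Sum>i\<le>n. int (card (pond_upto N i)) * fps_nth (pond_factor (Suc N)) (n - i))"
    by (simp add: fps_mult_nth Suc.IH atLeast0AtMost)
  also have "\<dots> = (\<Sum>i\<le>n. if fps_nth (pond_factor (Suc N)) (n - i) = 1 then int (card (pond_upto N i)) else 0)"
    by (rule sum.cong[OF refl], subst v) simp
  also have "\<dots> = (\<Sum>i | i \<in> {..n} \<and> fps_nth (pond_factor (Suc N)) (n - i) = 1. int (card (pond_upto N i)))"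
    by (rule sum.inter_filter[symmetric]) simp
  finally show ?case by (simp add: card_pond_upto_Suc)
qed

section \<open>The product formula for the generating function\<close>

definition pond_gf :: "int fps" where
  "pond_gf = Abs_fps (\<lambda>n. int (pond n))"

lemma pond_gf_approx:
  assumes "n \<le> Suc N"
  shows "fps_X ^ n dvd pond_gf - (\<Prod>k<N. pond_factor (Suc k))"
  unfolding fps_X_power_dvd_iff
  using assms by (auto simp: pond_gf_def fps_nth_prod_pond_factor pond_def pond_upto_eq)

lemma geometric_mult:
  assumes "k \<ge> 1"
  shows "(1 - fps_X ^ k) * Abs_fps (\<lambda>m. if k dvd m then 1 else 0) = (1 :: int fps)"
proof (rule fps_ext)
  fix n
  have "k dvd n \<longleftrightarrow> n = 0" if "n < k" using that by (auto dest: dvd_imp_le)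
  moreover have "k dvd n - k \<longleftrightarrow> k dvd n" if "k \<le> n" using that by (simp add: dvd_minus_self)
  ultimately show "fps_nth ((1 - fps_X ^ k) * Abs_fps (\<lambda>m. if k dvd m then 1 else 0)) n
      = fps_nth (1 :: int fps) n"
    using assms by (auto simp: left_diff_distrib fps_X_power_mult_nth)
qed

lemma pond_factor_even:
  assumes "even k" "k \<ge> 1"
  shows "pond_factor k * (1 - fps_X ^ k) = 1"
  using geometric_mult[OF assms(2)] assms(1) by (simp add: pond_factor_def mult.commute)

text \<open>The factor is 1/(1-x) - x, the geometric series without multiplicity one; times 1 - x^2
  it becomes 1 + x - x + x^3.\<close>

lemma pond_factor_odd:
  assumes "odd k"
  shows "pond_factor k * (1 - fps_X ^ (2 * k)) = 1 + fps_X ^ (3 * k)"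
proof -
  define x :: "int fps" where "x = fps_X ^ k"
  let ?g = "Abs_fps (\<lambda>m. if k dvd m then 1 else 0) :: int fps"
  have k: "k \<ge> 1" using assms by (cases k) auto
  have "pond_factor k = ?g - x"
    by (rule fps_ext) (use assms in \<open>auto simp: pond_factor_def x_def\<close>)
  moreover have "fps_X ^ (2 * k) = x * x" "fps_X ^ (3 * k) = x * x * x"
    unfolding x_def by (simp_all add: power_add[symmetric])
  moreover have "(?g - x) * (1 - x * x) = (1 + x) * ((1 - x) * ?g) - x + x * x * x"
    by (simp add: algebra_simps)
  ultimately show ?thesis using geometric_mult[OF k] by (simp add: x_def)
qed

lemma pond_gf_eq: "pond_gf * qprod (- 1) 2 2 * qprod (- 1) 4 2 = qprod 1 6 3"
proof (rule fps_eqI_dvd)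
  fix n
  have neg: "fps_const (- 1 :: int) = - 1" by (simp add: fps_const_neg[symmetric] del: fps_const_neg)
  have e: "pond_factor (2 * k + 2) * qfactor (- 1) 2 2 k = 1" for k
    using pond_factor_even[of "2 * k + 2"] by (simp add: qfactor_def neg)
  have o: "pond_factor (2 * k + 1) * qfactor (- 1) 4 2 k = qfactor 1 6 3 k" for k
  proof -
    have "2 * (2 * k + 1) = 4 * k + 2" "3 * (2 * k + 1) = 6 * k + 3" by auto
    then show ?thesis using pond_factor_odd[of "2 * k + 1"] by (simp only: qfactor_def neg) simp
  qed
  have eq: "(\<Prod>k<n * 2. pond_factor (Suc k)) * (\<Prod>k<n. qfactor (- 1) 2 2 k) * (\<Prod>k<n. qfactor (- 1) 4 2 k)
     = (\<Prod>k<n. qfactor 1 6 3 k)"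
  proof -
    have "(\<Prod>k<n * 2. pond_factor (Suc k))
      = (\<Prod>k<n. pond_factor (2 * k + 1)) * (\<Prod>k<n. pond_factor (2 * k + 2))"
      by (subst prod_lessThan_mult) (simp add: numeral_2_eq_2)
    then have "(\<Prod>k<n * 2. pond_factor (Suc k)) * (\<Prod>k<n. qfactor (- 1) 2 2 k) * (\<Prod>k<n. qfactor (- 1) 4 2 k)
      = (\<Prod>k<n. (pond_factor (2 * k + 2) * qfactor (- 1) 2 2 k) * (pond_factor (2 * k + 1) * qfactor (- 1) 4 2 k))"
      by (simp only: prod.distrib mult_ac)
    then show ?thesis by (simp only: e o) simp
  qed
  have "fps_X ^ n dvd pond_gf * qprod (- 1) 2 2 * qprod (- 1) 4 2
     - (\<Prod>k<n * 2. pond_factor (Suc k)) * (\<Prod>k<n. qfactor (- 1) 2 2 k) * (\<Prod>k<n. qfactor (- 1) 4 2 k)"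
    by (intro dvd_diff_mult qprod_approx pond_gf_approx) auto
  moreover have "fps_X ^ n dvd qprod 1 6 3 - (\<Prod>k<n. qfactor 1 6 3 k)"
    by (rule qprod_approx) auto
  ultimately show "fps_X ^ n dvd pond_gf * qprod (- 1) 2 2 * qprod (- 1) 4 2 - qprod 1 6 3"
    unfolding eq using dvd_diff_trans dvd_diff_sym by blast
qed

subsection \<open>Theta functions\<close>

text \<open>These are the theta functions \<open>\<phi>(-q)\<close>, \<open>\<psi>(s q)\<close> (for \<open>s = 1, -1\<close>) and \<open>\<Omega>(-q)\<close>, with the
  coefficients read off by completing the square: \<open>8 (2j\<^sup>2 - j) + 1 = (4j - 1)\<^sup>2\<close> and
  \<open>3 (3j\<^sup>2 - 2j) + 1 = (3j - 1)\<^sup>2\<close>.\<close>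

definition theta_phi :: "int fps" where
  "theta_phi = Abs_fps (\<lambda>n. if \<exists>m. n = m\<^sup>2 then (if n = 0 then 1 else 2 * (- 1) ^ n) else 0)"

definition theta_psi :: "int \<Rightarrow> int fps" where
  "theta_psi s = Abs_fps (\<lambda>n. if \<exists>m. 8 * n + 1 = m\<^sup>2 then s ^ n else 0)"

definition theta_omega :: "int fps" where
  "theta_omega = Abs_fps (\<lambda>n. if \<exists>m. 3 * n + 1 = m\<^sup>2 then (- 1) ^ n else 0)"

abbreviation euler :: "nat \<Rightarrow> int fps" where
  "euler k \<equiv> qprod (- 1) k k"

lemma qprod_split2:
  assumes "a \<ge> 1" "r \<ge> 1"
  shows "qprod s a r = qprod s (2 * a) r * qprod s (2 * a) (r + a)"
proof -
  have "{..<2} = {0, 1 :: nat}" by auto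
  then show ?thesis using qprod_split[OF assms, of 2 s] by simp
qed

lemma qprod_split3:
  assumes "a \<ge> 1" "r \<ge> 1"
  shows "qprod s a r = qprod s (3 * a) r * qprod s (3 * a) (r + a) * qprod s (3 * a) (r + 2 * a)"
proof -
  have "{..<3} = {0, 1, 2 :: nat}" by auto
  then show ?thesis using qprod_split[OF assms, of 3 s] by (simp add: mult.assoc)
qed

lemma euler_split: "k \<ge> 1 \<Longrightarrow> euler k = qprod (- 1) (2 * k) k * euler (2 * k)"
  using qprod_split2[of k k "- 1"] by (simp add: mult_2)

lemma pow_eq_if_odd: "s * s = (1 :: int) \<Longrightarrow> s ^ n = (if even n then 1 else s)"
  by (auto elim!: evenE oddE simp: power_mult power2_eq_square)

lemma ex_nat_square_iff: "(\<exists>m::nat. n = m\<^sup>2) \<longleftrightarrow> (\<exists>j::int. int n = j\<^sup>2)"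
proof
  assume "\<exists>j::int. int n = j\<^sup>2"
  then obtain j :: int where "int n = j\<^sup>2" by blast
  then have "n = (nat \<bar>j\<bar>)\<^sup>2" by (metis nat_int nat_power_eq abs_ge_zero power2_abs)
  then show "\<exists>m::nat. n = m\<^sup>2" by blast
qed (metis of_nat_power)

text \<open>The triple product with \<open>a = b = 1\<close> has exponents j^2; \<open>j\<close> and
  \<open>-j\<close> coincide only at 0, and \<open>j\<close> has the parity of j^2.\<close>

lemma theta_phi_eq: "theta_phi = qprod (- 1) 2 1 * qprod (- 1) 2 1 * euler 2"
proof (rule fps_ext)
  fix n
  have J: "jexp 1 1 j = j\<^sup>2" for j
    using two_jexp[of 1 1 j] by (simp add: power2_eq_square algebra_simps)
  have par: "(if even j then 1 else - 1 :: int) = (- 1) ^ n" if "j\<^sup>2 = int n" for j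
  proof -
    have "even j \<longleftrightarrow> even n" using that by (metis even_of_nat even_power pos2)
    then show ?thesis by simp
  qed
  have "fps_nth (qprod (- 1) 2 1 * qprod (- 1) 2 1 * euler 2) n
      = (\<Sum>j | j\<^sup>2 = int n. if even j then 1 else - 1)"
    using jacobi_triple_product[of "- 1" 1 1 n] unfolding J by (simp del: One_nat_def)
  also have "\<dots> = (\<Sum>j | j\<^sup>2 = int n. (- 1) ^ n)"
    by (rule sum.cong) (use par in auto)
  also have "\<dots> = int (card {j. j\<^sup>2 = int n}) * (- 1) ^ n" by simp
  also have "int (card {j. j\<^sup>2 = int n}) = (if \<exists>m. n = m\<^sup>2 then (if n = 0 then 1 else 2) else 0)"
  proof (cases "\<exists>m. n = m\<^sup>2")
    case True
    then obtain m where m: "n = m\<^sup>2" by blast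
    then have "{j. j\<^sup>2 = int n} = {int m, - int m}" by (auto simp: power2_eq_iff)
    then show ?thesis using m by (auto simp: card_insert_if)
  next
    case False
    then have "{j. j\<^sup>2 = int n} = {}" 
      using ex_nat_square_iff[of n] by (metis (mono_tags, lifting) empty_Collect_eq)
    then show ?thesis using False by simp
  qed
  finally show "fps_nth theta_phi n = fps_nth (qprod (- 1) 2 1 * qprod (- 1) 2 1 * euler 2) n"
    by (auto simp: theta_phi_def)
qed

text \<open>The triple product with \<open>a = 1\<close>, \<open>b = 3\<close>; its two factors
  modulo 4 merge into one product over odd exponents.\<close>

lemma theta_psi_eq:
  assumes s: "s * s = 1"
  shows "theta_psi s = qprod s 2 1 * euler 4"
proof (rule fps_ext)
  fix n
  have J: "jexp 1 3 j = 2 * j\<^sup>2 - j" for j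
    using two_jexp[of 1 3 j] by (simp add: power2_eq_square algebra_simps)
  have sq: "2 * j\<^sup>2 - j = int n \<longleftrightarrow> (4 * j - 1)\<^sup>2 = int (8 * n + 1)" for j :: int
    by (auto simp: power2_eq_square algebra_simps)
  have par: "(if even j then 1 else s) = s ^ n" if "2 * j\<^sup>2 - j = int n" for j
  proof -
    have "even (int n) \<longleftrightarrow> even j" unfolding that[symmetric] by simp
    then show ?thesis by (simp add: pow_eq_if_odd[OF s])
  qed
  have "qprod s 2 1 = qprod s 4 1 * qprod s 4 3"
    using qprod_split2[of 2 1 s] by (simp del: One_nat_def)
  then have "fps_nth (qprod s 2 1 * euler 4) n = (\<Sum>j | 2 * j\<^sup>2 - j = int n. if even j then 1 else s)"
    using jacobi_triple_product[OF s, of 1 3 n] unfolding J by (simp del: One_nat_def)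
  also have "\<dots> = (\<Sum>j | 2 * j\<^sup>2 - j = int n. s ^ n)"
    by (rule sum.cong) (use par in auto)
  also have "\<dots> = int (card {j. 2 * j\<^sup>2 - j = int n}) * s ^ n" by simp
  also have "int (card {j. 2 * j\<^sup>2 - j = int n}) = (if \<exists>m. 8 * n + 1 = m\<^sup>2 then 1 else 0)"
  proof (cases "\<exists>m. 8 * n + 1 = m\<^sup>2")
    case True
    then obtain m where m: "8 * n + 1 = m\<^sup>2" by blast
    have "odd (m\<^sup>2)" unfolding m[symmetric] by simp
    then have "odd m" by simp
    \<comment> \<open>The root \<open>m\<close> is odd, so exactly one of \<open>m\<close> and
      \<open>-m\<close> is 3 modulo 4; this also makes \<open>j\<close> unique.\<close>
    then obtain j :: int where j: "4 * j - 1 = int m \<or> 4 * j - 1 = - int m"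
    proof -
      assume *: "\<And>j. 4 * j - 1 = int m \<or> 4 * j - 1 = - int m \<Longrightarrow> thesis"
      have "m mod 4 = 1 \<or> m mod 4 = 3" using \<open>odd m\<close> by presburger
      then show thesis
      proof
        assume "m mod 4 = 1" then have "4 * - (int m div 4) - 1 = - int m" by presburger
        then show thesis using * by blast
      next
        assume "m mod 4 = 3" then have "4 * (int m div 4 + 1) - 1 = int m" by presburger
        then show thesis using * by blast
      qed
    qed
    have "int (8 * n + 1) = (int m)\<^sup>2" unfolding m by simp
    then have "i = j" if "(4 * i - 1)\<^sup>2 = int (8 * n + 1)" for i
    proof -
      have "4 * i - 1 = int m \<or> 4 * i - 1 = - int m"
        using that \<open>int (8 * n + 1) = (int m)\<^sup>2\<close> by (metis power2_eq_iff)
      then show ?thesis using j by presburger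
    qed
    moreover have "(4 * j - 1)\<^sup>2 = int (8 * n + 1)"
      using j \<open>int (8 * n + 1) = (int m)\<^sup>2\<close> by (metis power2_minus)
    ultimately have "{j. 2 * j\<^sup>2 - j = int n} = {j}" unfolding sq by blast
    then show ?thesis using True by simp
  next
    case False
    then have "{j. 2 * j\<^sup>2 - j = int n} = {}" unfolding sq 
      using ex_nat_square_iff[of "8 * n + 1"] by (metis (mono_tags, lifting) empty_Collect_eq)
    then show ?thesis using False by simp
  qed
  finally show "fps_nth (theta_psi s) n = fps_nth (qprod s 2 1 * euler 4) n"
    by (auto simp: theta_psi_def)
qed

lemma theta_omega_eq: "theta_omega = qprod (- 1) 6 1 * qprod (- 1) 6 5 * euler 6"
proof (rule fps_ext)
  fix n
  have J: "jexp 1 5 j = 3 * j\<^sup>2 - 2 * j" for j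
    using two_jexp[of 1 5 j] by (simp add: power2_eq_square algebra_simps)
  have sq: "3 * j\<^sup>2 - 2 * j = int n \<longleftrightarrow> (3 * j - 1)\<^sup>2 = int (3 * n + 1)" for j :: int
    by (auto simp: power2_eq_square algebra_simps)
  have par: "(if even j then 1 else - 1 :: int) = (- 1) ^ n" if "3 * j\<^sup>2 - 2 * j = int n" for j
  proof -
    have "even (int n) \<longleftrightarrow> even j" unfolding that[symmetric] by simp
    then show ?thesis by simp
  qed
  have "fps_nth (qprod (- 1) 6 1 * qprod (- 1) 6 5 * euler 6) n
      = (\<Sum>j | 3 * j\<^sup>2 - 2 * j = int n. if even j then 1 else - 1)"
    using jacobi_triple_product[of "- 1" 1 5 n] unfolding J by (simp del: One_nat_def)
  also have "\<dots> = (\<Sum>j | 3 * j\<^sup>2 - 2 * j = int n. (- 1) ^ n)"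
    by (rule sum.cong) (use par in auto)
  also have "\<dots> = int (card {j. 3 * j\<^sup>2 - 2 * j = int n}) * (- 1) ^ n" by simp
  also have "int (card {j. 3 * j\<^sup>2 - 2 * j = int n}) = (if \<exists>m. 3 * n + 1 = m\<^sup>2 then 1 else 0)"
  proof (cases "\<exists>m. 3 * n + 1 = m\<^sup>2")
    case True
    then obtain m where m: "3 * n + 1 = m\<^sup>2" by blast
    have "\<not> 3 dvd m\<^sup>2" unfolding m[symmetric] by presburger
    then have "\<not> 3 dvd m" by (auto simp: power2_eq_square)
    \<comment> \<open>As 3 does not divide \<open>m\<close>, exactly one of \<open>m\<close> and
      \<open>-m\<close> is 2 modulo 3.\<close>
    then obtain j :: int where j: "3 * j - 1 = int m \<or> 3 * j - 1 = - int m"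
    proof -
      assume *: "\<And>j. 3 * j - 1 = int m \<or> 3 * j - 1 = - int m \<Longrightarrow> thesis"
      have "m mod 3 = 1 \<or> m mod 3 = 2" using \<open>\<not> 3 dvd m\<close> by presburger
      then show thesis
      proof
        assume "m mod 3 = 1" then have "3 * - (int m div 3) - 1 = - int m" by presburger
        then show thesis using * by blast
      next
        assume "m mod 3 = 2" then have "3 * (int m div 3 + 1) - 1 = int m" by presburger
        then show thesis using * by blast
      qed
    qed
    have "int (3 * n + 1) = (int m)\<^sup>2" unfolding m by simp
    then have "i = j" if "(3 * i - 1)\<^sup>2 = int (3 * n + 1)" for i
    proof -
      have "3 * i - 1 = int m \<or> 3 * i - 1 = - int m"
        using that \<open>int (3 * n + 1) = (int m)\<^sup>2\<close> by (metis power2_eq_iff)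
      then show ?thesis using j by presburger
    qed
    moreover have "(3 * j - 1)\<^sup>2 = int (3 * n + 1)"
      using j \<open>int (3 * n + 1) = (int m)\<^sup>2\<close> by (metis power2_minus)
    ultimately have "{j. 3 * j\<^sup>2 - 2 * j = int n} = {j}" unfolding sq by blast
    then show ?thesis using True by simp
  next
    case False
    then have "{j. 3 * j\<^sup>2 - 2 * j = int n} = {}" unfolding sq 
      using ex_nat_square_iff[of "3 * n + 1"] by (metis (mono_tags, lifting) empty_Collect_eq)
    then show ?thesis using False by simp
  qed
  finally show "fps_nth theta_omega n = fps_nth (qprod (- 1) 6 1 * qprod (- 1) 6 5 * euler 6) n"
    by (auto simp: theta_omega_def)
qed

section \<open>Theta functions as quotients of Euler products\<close>

lemma theta_phi_euler: "theta_phi * euler 2 = euler 1 * euler 1"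
  using euler_split[of 1] by (simp add: theta_phi_eq mult_ac)

lemma theta_psi_minus_euler: "theta_psi (- 1) * euler 2 = euler 1 * euler 4"
  using euler_split[of 1] by (simp add: theta_psi_eq mult_ac)

lemma qprod_1_2_1_euler: "qprod 1 2 1 * (euler 1 * euler 4) = euler 2 * euler 2"
proof -
  have "qprod 1 2 1 * (euler 1 * euler 4) = (qprod 1 2 1 * qprod (- 1) 2 1) * euler 4 * euler 2"
    using euler_split[of 1] by (simp add: mult_ac)
  also have "\<dots> = euler 2 * euler 2"
    using qprod_conj[of 2 1] euler_split[of 2] by simp
  finally show ?thesis .
qed

lemma theta_psi_euler: "theta_psi 1 * euler 1 = euler 2 * euler 2"
  using qprod_1_2_1_euler by (simp add: theta_psi_eq mult_ac)

text \<open>The odd exponents in \<open>euler 1\<close> are split into the classes 1, 3, 5 modulo 6;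
  the class 3 is \<open>euler 3\<close> divided by \<open>euler 6\<close>.\<close>

lemma theta_omega_euler: "theta_omega * (euler 2 * euler 3) = euler 1 * (euler 6 * euler 6)"
proof -
  have "euler 1 = qprod (- 1) 6 1 * qprod (- 1) 6 3 * qprod (- 1) 6 5 * euler 2"
    using euler_split[of 1] qprod_split3[of 2 1 "- 1"] by (simp del: One_nat_def)
  moreover have "euler 3 = qprod (- 1) 6 3 * euler 6"
    using euler_split[of 3] by simp
  ultimately show ?thesis by (simp add: theta_omega_eq mult_ac)
qed

subsection \<open>Dilations and sections\<close>

definition dilate :: "nat \<Rightarrow> int fps \<Rightarrow> int fps" where
  "dilate k f = f oo fps_X ^ k"

definition trisect :: "nat \<Rightarrow> int fps \<Rightarrow> int fps" where
  "trisect r f = Abs_fps (\<lambda>n. fps_nth f (3 * n + r))"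

lemma dilate_nth:
  assumes "k \<ge> 1"
  shows "fps_nth (dilate k f) n = (if k dvd n then fps_nth f (n div k) else 0)"
proof -
  have "fps_nth (dilate k f) n = (\<Sum>i=0..n. if n = k * i then fps_nth f i else 0)"
    by (simp add: dilate_def fps_compose_nth power_mult[symmetric] if_distrib cong: if_cong)
  also have "\<dots> = (if k dvd n then fps_nth f (n div k) else 0)"
  proof (cases "k dvd n")
    case True
    then obtain m where m: "n = k * m" by auto
    have "(\<Sum>i=0..n. if n = k * i then fps_nth f i else 0) = (\<Sum>i=0..n. if m = i then fps_nth f i else 0)"
      using m assms by (intro sum.cong) auto
    then show ?thesis using m assms by simp
  next
    case False
    then have "n \<noteq> k * i" for i by auto
    then show ?thesis using False by simp
  qed
  finally show ?thesis .
qed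

lemma dilate_mult: "k \<ge> 1 \<Longrightarrow> dilate k (f * g) = dilate k f * dilate k g"
  by (simp add: dilate_def fps_compose_mult_distrib)

lemma dilate_add: "dilate k (f + g) = dilate k f + dilate k g"
  by (simp add: dilate_def fps_compose_add_distrib)

lemma dilate_diff: "dilate k (f - g) = dilate k f - dilate k g"
  by (simp add: dilate_def fps_compose_sub_distrib)

lemma dilate_const: "dilate k (fps_const c) = fps_const c"
  by (simp add: dilate_def)

lemma dilate_0: "dilate k 0 = 0"
  by (simp add: dilate_def)

lemma dilate_uminus: "dilate k (- f) = - dilate k f"
  by (simp add: dilate_def fps_compose_uminus)

lemma dilate_numeral: "dilate k (numeral c) = numeral c"
  by (simp add: numeral_fps_const dilate_const)

lemma dilate_X: "k \<ge> 1 \<Longrightarrow> dilate k fps_X = fps_X ^ k"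
  by (simp add: dilate_def)

lemma dilate_1: "dilate k 1 = 1"
  by (simp add: dilate_def)

lemma dilate_dilate: "k \<ge> 1 \<Longrightarrow> l \<ge> 1 \<Longrightarrow> dilate k (dilate l f) = dilate (k * l) f"
  by (rule fps_ext) (auto simp: dilate_nth div_mult2_eq elim!: dvdE)

lemma X_power_dvd_dilate:
  assumes "k \<ge> 1" "fps_X ^ n dvd f"
  shows "fps_X ^ n dvd dilate k f"
  unfolding fps_X_power_dvd_iff
proof (intro allI impI)
  fix i assume "i < n"
  then have "i div k < n" by (meson div_le_dividend le_less_trans)
  then show "fps_nth (dilate k f) i = 0"
    using assms by (simp add: dilate_nth fps_X_power_dvd_iff)
qed

lemma dilate_qprod:
  assumes "m \<ge> 1" "a \<ge> 1" "r \<ge> 1"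
  shows "dilate m (qprod s a r) = qprod s (m * a) (m * r)"
proof (rule fps_eqI_dvd)
  fix n
  have f: "dilate m (qfactor s a r k) = qfactor s (m * a) (m * r) k" for k
  proof -
    have "dilate m (fps_X ^ j) = fps_X ^ (m * j)" for j
      by (rule fps_ext) (use assms in \<open>auto simp: dilate_nth\<close>)
    then show ?thesis using assms
      by (simp add: qfactor_def dilate_add dilate_mult dilate_const dilate_1 algebra_simps)
  qed
  have p: "dilate m (\<Prod>k<N. qfactor s a r k) = (\<Prod>k<N. qfactor s (m * a) (m * r) k)" for N
    by (induction N) (use assms in \<open>auto simp: dilate_1 dilate_mult f\<close>)
  have "fps_X ^ n dvd dilate m (qprod s a r - (\<Prod>k<n. qfactor s a r k))"
    by (intro X_power_dvd_dilate qprod_approx) (use assms in auto)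
  then have "fps_X ^ n dvd dilate m (qprod s a r) - (\<Prod>k<n. qfactor s (m * a) (m * r) k)"
    by (simp add: dilate_diff p)
  moreover have "fps_X ^ n dvd qprod s (m * a) (m * r) - (\<Prod>k<n. qfactor s (m * a) (m * r) k)"
    by (rule qprod_approx) (use assms in auto)
  ultimately show "fps_X ^ n dvd dilate m (qprod s a r) - qprod s (m * a) (m * r)"
    using dvd_diff_trans dvd_diff_sym by blast
qed

lemma dilate_euler: "m \<ge> 1 \<Longrightarrow> k \<ge> 1 \<Longrightarrow> dilate m (euler k) = euler (m * k)"
  by (simp add: dilate_qprod)

lemma trisect_nth: "fps_nth (trisect r f) n = fps_nth f (3 * n + r)"
  by (simp add: trisect_def)

lemma trisect_add: "trisect r (f + g) = trisect r f + trisect r g"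
  by (rule fps_ext) (simp add: trisect_nth)

lemma trisect_diff: "trisect r (f - g) = trisect r f - trisect r g"
  by (rule fps_ext) (simp add: trisect_nth)

text \<open>Taking a section is linear over series in q^3: only indices \<open>3 * j\<close>
  contribute to the convolution, and \<open>r < 3\<close> forces \<open>j \<le> n\<close>.\<close>

lemma trisect_dilate_mult:
  assumes "r < 3"
  shows "trisect r (dilate 3 g * f) = g * trisect r f"
proof (rule fps_ext)
  fix n
  have "fps_nth (trisect r (dilate 3 g * f)) n
      = (\<Sum>i=0..3 * n + r. fps_nth (dilate 3 g) i * fps_nth f (3 * n + r - i))"
    by (simp add: trisect_nth fps_mult_nth)
  also have "\<dots> = (\<Sum>i\<in>(*) 3 ` {0..n}. fps_nth (dilate 3 g) i * fps_nth f (3 * n + r - i))"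
  proof (rule sum.mono_neutral_right)
    show "\<forall>i\<in>{0..3 * n + r} - (*) 3 ` {0..n}. fps_nth (dilate 3 g) i * fps_nth f (3 * n + r - i) = 0"
    proof
      fix i assume i: "i \<in> {0..3 * n + r} - (*) 3 ` {0..n}"
      have "\<not> 3 dvd i"
      proof
        assume "3 dvd i"
        then obtain j where "i = 3 * j" by auto
        then show False using i assms by auto
      qed
      then show "fps_nth (dilate 3 g) i * fps_nth f (3 * n + r - i) = 0" by (simp add: dilate_nth)
    qed
  qed auto
  also have "\<dots> = (\<Sum>j=0..n. fps_nth g j * fps_nth f (3 * (n - j) + r))"
    by (subst sum.reindex) (auto simp: inj_on_def dilate_nth diff_mult_distrib2 intro!: sum.cong)
  finally show "fps_nth (trisect r (dilate 3 g * f)) n = fps_nth (g * trisect r f) n"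
    by (simp add: trisect_nth fps_mult_nth)
qed

lemma trisect_X_power:
  assumes "r < 3" "j < 3"
  shows "trisect r (fps_X ^ j) = (if j = r then 1 else 0)"
proof (rule fps_ext)
  fix n
  have "3 * n + r = j \<longleftrightarrow> n = 0 \<and> j = r" using assms by presburger
  then show "fps_nth (trisect r (fps_X ^ j)) n = fps_nth (if j = r then 1 else 0) n"
    by (simp add: trisect_nth)
qed

lemma trisect_X_dilate:
  assumes "r < 3" "j < 3"
  shows "trisect r (fps_X ^ j * dilate 3 f) = (if j = r then f else 0)"
  using trisect_dilate_mult[OF assms(1), of f "fps_X ^ j"] trisect_X_power[OF assms]
  by (simp add: mult.commute)

lemma trisect_decomp:
  "f = dilate 3 (trisect 0 f) + fps_X * dilate 3 (trisect 1 f) + fps_X ^ 2 * dilate 3 (trisect 2 f)"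
proof (rule fps_ext)
  fix n
  have X1: "fps_nth (fps_X * dilate 3 g) n = (if n < 1 then 0 else fps_nth (dilate 3 g) (n - 1))" for g
    using fps_X_power_mult_nth[of 1 "dilate 3 g" n] by simp
  obtain m where "n = 3 * m \<or> n = 3 * m + 1 \<or> n = 3 * m + 2"
    by (metis add.commute add.right_neutral mod_mult_div_eq mod_less_divisor
        less_Suc_eq numeral_3_eq_3 numeral_2_eq_2 One_nat_def zero_less_Suc less_nat_zero_code)
  moreover have "\<not> 3 dvd 3 * m - Suc 0" "\<not> 3 dvd 3 * m - 2" if "m > 0"
    using that by presburger+
  moreover have "\<not> 3 dvd 3 * m + 1" "\<not> 3 dvd 3 * m + 2" "\<not> 3 dvd Suc (3 * m)" "\<not> 3 dvd Suc (Suc (3 * m))" by presburger+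
  ultimately show "fps_nth f n = fps_nth (dilate 3 (trisect 0 f) + fps_X * dilate 3 (trisect 1 f) + fps_X ^ 2 * dilate 3 (trisect 2 f)) n"
    by (cases "m = 0") (auto simp: X1 dilate_nth trisect_nth fps_X_power_mult_nth)
qed

lemma trisect_const_dvd:
  "fps_const c dvd f \<Longrightarrow> fps_const c dvd trisect r f"
  by (simp add: fps_const_dvd_iff trisect_nth)

text \<open>Write \<open>f = c + X g\<close> and expand the cube: the mixed terms carry a factor 3,
  c^3 - c is divisible by 3, and the remaining term is X^3 times the same difference for
  \<open>g\<close>, whose coefficient has index \<open>n - 3\<close>.\<close>

lemma frobenius_3: "fps_const 3 dvd f ^ 3 - dilate 3 f"
  unfolding fps_const_dvd_iff
proof
  fix n
  show "3 dvd fps_nth (f ^ 3 - dilate 3 f) n"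
  proof (induction n arbitrary: f rule: less_induct)
    case (less n)
    define c where "c = fps_nth f 0"
    define g where "g = fps_shift 1 f"
    have f: "f = fps_const c + fps_X * g"
      by (rule fps_ext) (auto simp: c_def g_def)
    have "f ^ 3 - dilate 3 f = fps_const (c ^ 3 - c) + fps_const 3 * (fps_const (c * c) * fps_X * g + fps_const c * fps_X * fps_X * g * g)
       + fps_X ^ 3 * (g ^ 3 - dilate 3 g)"
    proof -
      have "dilate 3 f = fps_const c + fps_X ^ 3 * dilate 3 g"
        by (simp add: f dilate_add dilate_mult dilate_const dilate_X)
      moreover have "fps_const (3 :: int) = 3" by (simp add: numeral_fps_const)
      moreover have "fps_const (c ^ 3 - c) = fps_const c ^ 3 - fps_const c"
        by (simp add: fps_const_power)
      moreover have "fps_const (c * c) = fps_const c * fps_const c" by simp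
      ultimately show ?thesis unfolding f
        by (simp only: power3_eq_cube) (simp add: algebra_simps del: fps_const_mult)
    qed
    then have "fps_nth (f ^ 3 - dilate 3 f) n = fps_nth (fps_const (c ^ 3 - c)) n
       + 3 * fps_nth (fps_const (c * c) * fps_X * g + fps_const c * fps_X * fps_X * g * g) n
       + (if n < 3 then 0 else fps_nth (g ^ 3 - dilate 3 g) (n - 3))"
      by (simp add: fps_X_power_mult_nth)
    moreover have "3 dvd c ^ 3 - c"
    proof -
      have "3 dvd c - 1 \<or> 3 dvd c \<or> 3 dvd c + 1" by presburger
      then have "3 dvd (c - 1) * c * (c + 1)" by auto
      then show ?thesis by (simp add: power3_eq_cube algebra_simps)
    qed
    then have "3 dvd fps_nth (fps_const (c ^ 3 - c)) n" by simp
    moreover have "3 dvd (if n < 3 then 0 else fps_nth (g ^ 3 - dilate 3 g) (n - 3))"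
      using less.IH[of "n - 3" g] by simp
    ultimately show ?case by (simp only: dvd_add dvd_triv_left)
  qed
qed

section \<open>Squares modulo 3 and the sections of the theta functions\<close>

lemma neg_one_pow_3: "(- 1 :: int) ^ (3 * n) = (- 1) ^ n"
  by (simp add: power_mult)

lemma square_mod_3: "(m :: nat)\<^sup>2 mod 3 = (if 3 dvd m then 0 else 1)"
proof -
  have "m mod 3 = 0 \<or> m mod 3 = 1 \<or> m mod 3 = 2" by presburger
  then show ?thesis
    by (auto simp: mod_eq_0_iff_dvd[symmetric] power_mod[symmetric, of m])
qed

lemma three_mult_square_iff: "(\<exists>m::nat. 3 * n = m\<^sup>2) \<longleftrightarrow> 3 dvd n \<and> (\<exists>m. n div 3 = m\<^sup>2)"
proof
  assume "\<exists>m. 3 * n = m\<^sup>2"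
  then obtain m where m: "3 * n = m\<^sup>2" by blast
  then have "m\<^sup>2 mod 3 = 0" by (metis mod_mult_self1_is_0)
  then have "3 dvd m" by (simp add: square_mod_3 split: if_splits)
  then obtain l where "m = 3 * l" by auto
  then have "n = 3 * l\<^sup>2" using m by (simp add: power2_eq_square)
  then show "3 dvd n \<and> (\<exists>m. n div 3 = m\<^sup>2)" by auto
next
  assume *: "3 dvd n \<and> (\<exists>m. n div 3 = m\<^sup>2)"
  then obtain m where "n div 3 = m\<^sup>2" by blast
  then have "3 * n = (3 * m)\<^sup>2" using * by (auto simp: power2_eq_square elim!: dvdE)
  then show "\<exists>m. 3 * n = m\<^sup>2" by blast
qed

lemma trisect_theta_phi:
  "trisect 0 theta_phi = dilate 3 theta_phi" "trisect 1 theta_phi = - 2 * theta_omega" "trisect 2 theta_phi = 0"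
proof -
  show "trisect 0 theta_phi = dilate 3 theta_phi"
    by (rule fps_ext) (auto simp: trisect_nth dilate_nth theta_phi_def three_mult_square_iff neg_one_pow_3 elim!: dvdE)
  show "trisect 1 theta_phi = - 2 * theta_omega"
  proof (rule fps_ext)
    fix n
    have "fps_nth (- 2 * theta_omega) n = - 2 * fps_nth theta_omega n"
      by (simp add: numeral_fps_const)
    then show "fps_nth (trisect 1 theta_phi) n = fps_nth (- 2 * theta_omega) n"
      by (simp add: trisect_nth theta_phi_def theta_omega_def neg_one_pow_3)
  qed
  have "3 * n + 2 \<noteq> m\<^sup>2" for m n :: nat
  proof
    assume "3 * n + 2 = m\<^sup>2"
    then have "m\<^sup>2 mod 3 = 2" by presburger
    then show False by (simp add: square_mod_3 split: if_splits)
  qed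
  then show "trisect 2 theta_phi = 0"
    by (intro fps_ext) (simp add: trisect_nth theta_phi_def)
qed

text \<open>Here 8(3n+1)+1 = 3(8n+3) can be a square only if 3 divides \<open>n\<close>, and then
  8(n/3)+1 is a square; 8(3n+2)+1 is 2 modulo 3 and never a square.\<close>

lemma trisect_theta_psi:
  "trisect 1 (theta_psi (- 1)) = - dilate 3 (theta_psi (- 1))" "trisect 2 (theta_psi s) = 0"
proof -
  have "(\<exists>m. 8 * (3 * n + 1) + 1 = m\<^sup>2) \<longleftrightarrow> 3 dvd n \<and> (\<exists>m. 8 * (n div 3) + 1 = m\<^sup>2)" for n :: nat
  proof -
    have "8 * (3 * n + 1) + 1 = 3 * (8 * n + 3)" by simp
    then have "(\<exists>m. 8 * (3 * n + 1) + 1 = m\<^sup>2) \<longleftrightarrow> 3 dvd 8 * n + 3 \<and> (\<exists>m. (8 * n + 3) div 3 = m\<^sup>2)"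
      by (simp only: three_mult_square_iff)
    moreover have "3 dvd 8 * n + 3 \<longleftrightarrow> 3 dvd n" by presburger
    moreover have "(8 * n + 3) div 3 = 8 * (n div 3) + 1" if "3 dvd n" using that by auto
    ultimately show ?thesis by (cases "3 dvd n") simp_all
  qed
  then show "trisect 1 (theta_psi (- 1)) = - dilate 3 (theta_psi (- 1))"
    by (intro fps_ext) (auto simp: trisect_nth dilate_nth theta_psi_def neg_one_pow_3 elim!: dvdE)
  have "8 * (3 * n + 2) + 1 \<noteq> m\<^sup>2" for m n :: nat
  proof
    assume "8 * (3 * n + 2) + 1 = m\<^sup>2"
    then have "m\<^sup>2 mod 3 = 2" by presburger
    then show False by (simp add: square_mod_3 split: if_splits)
  qed
  then show "trisect 2 (theta_psi s) = 0"
    by (intro fps_ext) (simp add: trisect_nth theta_psi_def)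
qed

subsection \<open>The congruences\<close>

abbreviation "phi2 \<equiv> dilate 2 theta_phi"
abbreviation "phi6 \<equiv> dilate 6 theta_phi"
abbreviation "omega2 \<equiv> dilate 2 theta_omega"
abbreviation "psi_neg \<equiv> theta_psi (- 1)"

lemma pond_gf_theta: "pond_gf * phi2 = dilate 3 (qprod 1 2 1)"
proof -
  have "phi2 = (qprod (- 1) 4 2 * euler 4) * qprod (- 1) 4 2"
    by (simp add: theta_phi_eq dilate_mult dilate_qprod mult_ac)
  also have "qprod (- 1) 4 2 * euler 4 = euler 2" using euler_split[of 2] by simp
  finally have "pond_gf * phi2 = pond_gf * qprod (- 1) 2 2 * qprod (- 1) 4 2" by (simp add: mult_ac)
  also have "\<dots> = dilate 3 (qprod 1 2 1)"
    unfolding pond_gf_eq using dilate_qprod[of 3 2 1 1] by simp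
  finally show ?thesis .
qed

section \<open>The 3-dissection and the moduli 4 and 2\<close>

lemma theta_phi_dissection: "theta_phi = dilate 9 theta_phi - 2 * fps_X * dilate 3 theta_omega"
  using trisect_decomp[of theta_phi] unfolding trisect_theta_phi
  by (simp add: dilate_dilate dilate_0 dilate_mult dilate_uminus dilate_numeral mult_ac)

lemma phi2_dissection: "phi2 = dilate 3 phi6 - 2 * fps_X\<^sup>2 * dilate 3 omega2"
proof -
  have "phi2 = dilate 2 (dilate 9 theta_phi) - dilate 2 (fps_const 2 * (fps_X * dilate 3 theta_omega))"
    unfolding dilate_diff[symmetric] using theta_phi_dissection by (simp add: numeral_fps_const mult.assoc)
  then show ?thesis
    by (simp add: dilate_mult dilate_const dilate_X dilate_dilate numeral_fps_const mult.assoc)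
qed

text \<open>With \<open>u = \<phi>(-q\<^sup>1\<^sup>8)\<close> and \<open>w = \<Omega>(-q\<^sup>6)\<close>, multiplying by
  \<open>u\<^sup>2 + 2 q\<^sup>2 u w + 4 q\<^sup>4 w\<^sup>2\<close> turns \<open>\<phi>(-q\<^sup>2) = u - 2 q\<^sup>2 w\<close> into
  \<open>u\<^sup>3 - 8 q\<^sup>6 w\<^sup>3\<close>, a series in \<open>q\<^sup>3\<close>; this series with \<open>q\<close> for \<open>q\<^sup>3\<close> is \<open>pond_den\<close>.\<close>

definition pond_den :: "int fps" where
  "pond_den = phi6 ^ 3 - fps_const 8 * fps_X\<^sup>2 * omega2 ^ 3"

lemma dilate_power: "k \<ge> 1 \<Longrightarrow> dilate k (f ^ n) = dilate k f ^ n"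
  by (induction n) (simp_all add: dilate_1 dilate_mult)

lemma dilate_3_pond_den:
  "dilate 3 pond_den = phi2 * ((dilate 3 phi6)\<^sup>2 + 2 * fps_X\<^sup>2 * dilate 3 phi6 * dilate 3 omega2
     + 4 * (fps_X\<^sup>2 * fps_X\<^sup>2) * (dilate 3 omega2)\<^sup>2)"
proof -
  define u w x :: "int fps" where "u = dilate 3 phi6" and "w = dilate 3 omega2" and "x = fps_X\<^sup>2"
  have "dilate 3 pond_den = u ^ 3 - 8 * (fps_X ^ 3)\<^sup>2 * w ^ 3"
    by (simp add: pond_den_def dilate_diff dilate_mult dilate_power dilate_const dilate_X u_def w_def numeral_fps_const)
  also have "(fps_X ^ 3)\<^sup>2 = x ^ 3" by (simp add: x_def power_mult[symmetric])
  also have "u ^ 3 - 8 * x ^ 3 * w ^ 3 = (u - 2 * x * w) * (u\<^sup>2 + 2 * x * u * w + 4 * (x * x) * w\<^sup>2)"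
    by (simp add: power2_eq_square power3_eq_cube algebra_simps)
  also have "u - 2 * x * w = phi2" using phi2_dissection by (simp add: u_def w_def x_def)
  finally show ?thesis by (simp add: u_def w_def x_def)
qed

lemma pond_gf_den:
  "dilate 3 pond_den * pond_gf = dilate 3 (qprod 1 2 1) *
     (fps_X ^ 0 * dilate 3 (phi6\<^sup>2) + fps_X ^ 2 * dilate 3 (fps_const 2 * phi6 * omega2)
      + fps_X ^ 1 * dilate 3 (fps_const 4 * fps_X * omega2\<^sup>2))"
proof -
  let ?f = "(dilate 3 phi6)\<^sup>2 + 2 * fps_X\<^sup>2 * dilate 3 phi6 * dilate 3 omega2
     + 4 * (fps_X\<^sup>2 * fps_X\<^sup>2) * (dilate 3 omega2)\<^sup>2"
  have "dilate 3 pond_den * pond_gf = (pond_gf * phi2) * ?f"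
    unfolding dilate_3_pond_den by (simp only: mult_ac)
  \<comment> \<open>Since q^4 = q * q^3, the term with coefficient 4 falls on the exponents that are
    1 modulo 3.\<close>
  moreover have "fps_X\<^sup>2 * fps_X\<^sup>2 = fps_X * (fps_X ^ 3 :: int fps)"
    by (simp add: power_add[symmetric] power_Suc[symmetric] del: power_Suc)
  ultimately show ?thesis unfolding pond_gf_theta
    by (simp add: dilate_mult dilate_power dilate_const dilate_X numeral_fps_const mult_ac)
qed

lemma trisect_pond_gf:
  "pond_den * trisect 1 pond_gf = qprod 1 2 1 * (fps_const 4 * fps_X * omega2\<^sup>2)"
  "pond_den * trisect 2 pond_gf = qprod 1 2 1 * (fps_const 2 * phi6 * omega2)"
proof -
  have "pond_den * trisect r pond_gf = qprod 1 2 1 * trisect r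
     (fps_X ^ 0 * dilate 3 (phi6\<^sup>2) + fps_X ^ 2 * dilate 3 (fps_const 2 * phi6 * omega2)
      + fps_X ^ 1 * dilate 3 (fps_const 4 * fps_X * omega2\<^sup>2))" if "r < 3" for r
    using that by (simp only: trisect_dilate_mult[symmetric] pond_gf_den)
  then show "pond_den * trisect 1 pond_gf = qprod 1 2 1 * (fps_const 4 * fps_X * omega2\<^sup>2)"
    "pond_den * trisect 2 pond_gf = qprod 1 2 1 * (fps_const 2 * phi6 * omega2)"
    by (simp_all only: trisect_add trisect_X_dilate) simp_all
qed

lemma pond_den_nth_0: "fps_nth pond_den 0 = 1"
  by (simp add: pond_den_def dilate_nth theta_phi_def power3_eq_cube power2_eq_square)

lemma trisect_pond_gf_dvd:
  "fps_const 4 dvd trisect 1 pond_gf" "fps_const 2 dvd trisect 2 pond_gf"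
  by (rule fps_unit_dvd[OF pond_den_nth_0], unfold trisect_pond_gf, simp add: mult.assoc)+

section \<open>The modulus 3\<close>

lemma pond_den_cong: "fps_const 3 dvd pond_den - phi2"
proof -
  define u w x :: "int fps" where "u = dilate 3 phi6" and "w = dilate 3 omega2" and "x = fps_X\<^sup>2"
  have phi2: "phi2 = u - 2 * x * w" using phi2_dissection by (simp add: u_def w_def x_def)
  \<comment> \<open>The cofactor u^2 + 2xuw + 4x^2w^2 exceeds the square of u - 2xw by 6xuw.\<close>
  have "dilate 3 pond_den - phi2 ^ 3 = fps_const 3 * (2 * x * u * w * phi2)"
    unfolding dilate_3_pond_den u_def[symmetric] w_def[symmetric] x_def[symmetric] phi2
    by (simp add: power2_eq_square power3_eq_cube algebra_simps numeral_fps_const[symmetric])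
  then have "fps_const 3 dvd dilate 3 pond_den - phi2 ^ 3" by simp
  then have "fps_const 3 dvd dilate 3 pond_den - dilate 3 phi2"
    using frobenius_3 by (rule dvd_diff_trans)
  then have "fps_const 3 dvd trisect 0 (fps_X ^ 0 * dilate 3 (pond_den - phi2))"
    by (intro trisect_const_dvd) (simp add: dilate_diff)
  then show ?thesis by (subst (asm) trisect_X_dilate) auto
qed

text \<open>With \<open>pond_den\<close> replaced by \<open>phi2\<close>, the section is 2
  \<open>?A * phi6 * omega2\<close> over \<open>phi2\<close>; as Euler products this quotient is 2
  f_2 f_6 f_12 / (f_1 f_4), and f_1 f_4 / f_2 is \<open>psi_neg\<close>.\<close>

lemma trisect_2_pond_gf_cong:
  "fps_const 3 dvd trisect 2 pond_gf * psi_neg - fps_const 2 * (euler 6 * euler 12)"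
proof -
  let ?S = "trisect 2 pond_gf" and ?A = "qprod 1 2 1"
  have 0: "fps_const 3 dvd (?S * phi2 - fps_const 2 * ?A * phi6 * omega2)"
  proof -
    have "fps_const 3 dvd (pond_den - phi2) * ?S" using pond_den_cong by simp
    then have "fps_const 3 dvd pond_den * ?S - phi2 * ?S" by (simp add: left_diff_distrib)
    then have "fps_const 3 dvd phi2 * ?S - pond_den * ?S" by (rule dvd_diff_sym)
    then show ?thesis unfolding trisect_pond_gf by (simp add: mult_ac)
  qed
  have p2: "phi2 * euler 4 = euler 2 * euler 2"
    using arg_cong[OF theta_phi_euler, of "dilate 2"] by (simp add: dilate_mult dilate_euler)
  have p6: "phi6 * euler 12 = euler 6 * euler 6"
    using arg_cong[OF theta_phi_euler, of "dilate 6"] by (simp add: dilate_mult dilate_euler)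
  have o2: "omega2 * (euler 4 * euler 6) = euler 2 * (euler 12 * euler 12)"
    using arg_cong[OF theta_omega_euler, of "dilate 2"] by (simp add: dilate_mult dilate_euler)
  note pm = theta_psi_minus_euler and A = qprod_1_2_1_euler
  \<comment> \<open>\<open>?M\<close> clears the denominators of all theta functions involved;
    \<open>?U\<close> is the product of Euler factors then common to both terms.\<close>
  let ?M = "psi_neg * euler 1 * euler 2 * euler 4 * euler 4 * euler 4 * euler 6 * euler 12"
  let ?U = "euler 1 * euler 2 * euler 2 * euler 2 * euler 4 * euler 4 * euler 6 * euler 12"
  have "?M * (?S * phi2) = ?S * psi_neg * (phi2 * euler 4) * euler 1 * euler 2 * euler 4 * euler 4 * euler 6 * euler 12"
    by (simp only: mult_ac)
  also have "\<dots> = ?U * (?S * psi_neg)" unfolding p2 by (simp only: mult_ac)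
  finally have 1: "?M * (?S * phi2) = ?U * (?S * psi_neg)" .
  have "?M * (fps_const 2 * ?A * phi6 * omega2)
     = fps_const 2 * (psi_neg * euler 2) * (?A * (euler 1 * euler 4)) * (phi6 * euler 12) * (omega2 * (euler 4 * euler 6)) * euler 4"
    by (simp only: mult_ac)
  also have "\<dots> = ?U * (fps_const 2 * (euler 6 * euler 12))"
    unfolding p6 o2 pm A by (simp only: mult_ac)
  finally have 2: "?M * (fps_const 2 * ?A * phi6 * omega2) = ?U * (fps_const 2 * (euler 6 * euler 12))" .
  have "fps_const 3 dvd ?M * (?S * phi2 - fps_const 2 * ?A * phi6 * omega2)"
    using 0 by (rule dvd_mult)
  then have "fps_const 3 dvd ?U * (?S * psi_neg - fps_const 2 * (euler 6 * euler 12))"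
    unfolding right_diff_distrib 1 2 .
  then show ?thesis by (rule fps_unit_dvd[rotated]) (simp add: qprod_nth_0)
qed

text \<open>\<open>psi_neg\<close> has the form P(q^3) - q R(q^3), and only the square of the second
  term reaches exponents 2 modulo 3.\<close>

lemma trisect_2_psi_neg_square: "trisect 2 (psi_neg * psi_neg) = dilate 3 (psi_neg * psi_neg)"
proof -
  define p where "p = trisect 0 psi_neg"
  define r where "r = dilate 3 psi_neg"
  have "psi_neg = dilate 3 p - fps_X * dilate 3 r"
    using trisect_decomp[of psi_neg] unfolding trisect_theta_psi p_def r_def
    by (simp add: dilate_0 dilate_uminus)
  then have "psi_neg * psi_neg = (dilate 3 p - fps_X * dilate 3 r) * (dilate 3 p - fps_X * dilate 3 r)" by simp
  also have "\<dots> = fps_X ^ 0 * dilate 3 (p * p) - fps_X ^ 1 * dilate 3 (fps_const 2 * (p * r)) + fps_X ^ 2 * dilate 3 (r * r)"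
    by (simp add: dilate_mult dilate_const numeral_fps_const power2_eq_square algebra_simps)
  finally have "trisect 2 (psi_neg * psi_neg) = r * r"
    by (simp only: trisect_add trisect_diff trisect_X_dilate) simp
  then show ?thesis by (simp add: r_def dilate_mult)
qed

text \<open>Multiplying the previous congruence by \<open>psi_neg\<close> squared produces a cube,
  hence modulo 3 a series in q^3. As \<open>euler 6 * euler 12\<close> is one too, section 2 acts
  only on \<open>?S\<close> and on the square of \<open>psi_neg\<close>.\<close>

lemma trisect_2_2_pond_gf_cong:
  "fps_const 3 dvd trisect 2 (trisect 2 pond_gf) - fps_const 2 * (dilate 3 (psi_neg * psi_neg) * theta_psi 1)"
proof -
  let ?S = "trisect 2 pond_gf" and ?T = "trisect 2 (trisect 2 pond_gf)"
  have "fps_const 3 dvd (psi_neg * psi_neg) * (?S * psi_neg - fps_const 2 * (euler 6 * euler 12))"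
    using trisect_2_pond_gf_cong by (rule dvd_mult)
  moreover have "fps_const 3 dvd (psi_neg ^ 3 - dilate 3 psi_neg) * ?S"
    using frobenius_3 by (rule dvd_mult2)
  ultimately have "fps_const 3 dvd (psi_neg * psi_neg) * (?S * psi_neg - fps_const 2 * (euler 6 * euler 12))
      - (psi_neg ^ 3 - dilate 3 psi_neg) * ?S"
    by (rule dvd_diff)
  moreover have "(psi_neg * psi_neg) * (?S * psi_neg - fps_const 2 * (euler 6 * euler 12))
      - (psi_neg ^ 3 - dilate 3 psi_neg) * ?S
    = dilate 3 psi_neg * ?S - dilate 3 (fps_const 2 * (euler 2 * euler 4)) * (psi_neg * psi_neg)"
    by (simp add: dilate_mult dilate_const dilate_euler power3_eq_cube algebra_simps)
  ultimately have "fps_const 3 dvd trisect 2 (dilate 3 psi_neg * ?S - dilate 3 (fps_const 2 * (euler 2 * euler 4)) * (psi_neg * psi_neg))"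
    by (metis trisect_const_dvd)
  then have "fps_const 3 dvd psi_neg * ?T - fps_const 2 * (euler 2 * euler 4) * dilate 3 (psi_neg * psi_neg)"
    by (simp only: trisect_diff trisect_dilate_mult trisect_2_psi_neg_square)
  \<comment> \<open>The factor \<open>euler 2\<close> completes both
    \<open>psi_neg * euler 2\<close> and the square \<open>euler 2 * euler 2\<close>, so that
    \<open>euler 1 * euler 4\<close> can be cancelled.\<close>
  then have "fps_const 3 dvd euler 2 * (psi_neg * ?T - fps_const 2 * (euler 2 * euler 4) * dilate 3 (psi_neg * psi_neg))"
    by (rule dvd_mult)
  also have "euler 2 * (psi_neg * ?T - fps_const 2 * (euler 2 * euler 4) * dilate 3 (psi_neg * psi_neg))
    = (psi_neg * euler 2) * ?T - fps_const 2 * (euler 2 * euler 2) * euler 4 * dilate 3 (psi_neg * psi_neg)"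
    by (simp only: right_diff_distrib mult_ac)
  also have "\<dots> = (euler 1 * euler 4) * (?T - fps_const 2 * (dilate 3 (psi_neg * psi_neg) * theta_psi 1))"
    unfolding theta_psi_minus_euler theta_psi_euler[symmetric] by (simp only: right_diff_distrib mult_ac)
  finally show ?thesis by (rule fps_unit_dvd[rotated]) (simp add: qprod_nth_0)
qed

lemma trisect_2_2_2_pond_gf_dvd: "fps_const 3 dvd trisect 2 (trisect 2 (trisect 2 pond_gf))"
proof -
  have "fps_const 2 * (dilate 3 (psi_neg * psi_neg) * theta_psi 1) = dilate 3 (fps_const 2 * (psi_neg * psi_neg)) * theta_psi 1"
    by (simp add: dilate_mult dilate_const mult_ac)
  then have "trisect 2 (fps_const 2 * (dilate 3 (psi_neg * psi_neg) * theta_psi 1)) = 0"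
    by (simp only: trisect_dilate_mult trisect_theta_psi) simp
  then show ?thesis
    using trisect_const_dvd[OF trisect_2_2_pond_gf_cong, of 2] by (simp add: trisect_diff)
qed

theorem theorem1:
  fixes n :: nat
  shows "[pond (3 * n + 2) = 0] (mod 2)
       \<and> [pond (27 * n + 26) = 0] (mod 3)
       \<and> [pond (3 * n + 1) = 0] (mod 4)"
proof -
  have "2 dvd int (pond (3 * n + 2))" "4 dvd int (pond (3 * n + 1))"
    using trisect_pond_gf_dvd unfolding fps_const_dvd_iff trisect_nth pond_gf_def by simp_all
  moreover have "3 dvd int (pond (27 * n + 26))"
  proof -
    \<comment> \<open>Three iterations of \<open>n\<close> to \<open>3 * n + 2\<close>, one for each
      section.\<close>
    have "27 * n + 26 = 3 * (3 * (3 * n + 2) + 2) + 2" by simp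
    then show ?thesis
      using trisect_2_2_2_pond_gf_dvd
      by (simp only: fps_const_dvd_iff trisect_nth pond_gf_def fps_nth_Abs_fps)
  qed
  ultimately have "2 dvd pond (3 * n + 2)" "4 dvd pond (3 * n + 1)" "3 dvd pond (27 * n + 26)"
    by presburger+
  then show ?thesis by (simp add: cong_0_iff)
qed

end
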